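(* Let $\varphi$ be an $H$-flow on $M$. Let $K_0\subset M$ be a compact set with nonempty interior. For every compact set $K\supset K_0$, every $0<\delta<1$ and every $0<\eta<1$, there exist $T_{\min}>0$, $S_1>0$ and $D_1>0$ such that for every $S\ge S_1$, all $x_0,y_0,z_0$ in $K$, and all $T_0,T_1\ge T_{\min}$, we have $$\mathcal N_{\mathcal C}(x_0,y_0,\eta,T_0,T_0+5\tau_{K_0},\delta)\times\mathcal N_{\mathcal C}(y_0,z_0,\eta,T_1,T_1+5\tau_{K_0},\delta)\le D_1\,(T_0+T_1+S)\,\#\mathcal P_{K_0}(T_0+T_1+S,\,T_0+T_1+S+5\tau_{K_0}).$$
   Context: **Setting.** $(M,g)$ is a complete connected (not necessarily compact) Riemannian manifold with associated distance $d$; $B(x,r)$ is the open ball. **$H$-flow.** An $H$-flow is a $C^1$ flow $(\varphi_t)_{t\in\mathbb R}$ on a complete Riemannian manifold such that: (1) there is a constant $lip(\varphi)$ with $d(\varphi_\tau(x),\varphi_\tau(y))\le lip(\varphi)\,d(x,y)$ for all $x,y\in M$, $\tau\in[-1,1]$; (2) there exist $0<a\le b$ such that for every $x\in M$ there is $\rho>0$ with $a|t|\le d(x,\varphi_t(x))\le b|t|$ for all $t\in[-\rho,\rho]$; (3) (transitivity) for all nonempty open $U,V\subset M$ and every $T>0$ there is $t\ge T$ with $\varphi_t(U)\cap V\ne\emptyset$; (4) (finite exact shadowing) for every compact $K\subset M$, $\delta>0$ and integer $N\ge1$ there is $\eta>0$ such that, for all $x_1,\dots,x_N\in K$ and $t_1,\dots,t_N\ge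 0$ with $d(\varphi_{t_i}(x_i),x_{i+1})<\eta$ for $1\le i\le N-1$, there is $y\in M$ with $d(\varphi_{s+\sum_{j=1}^{i-1}t_j}(y),\varphi_s(x_i))<\delta$ for all $1\le i\le N$ and $0\le s\le t_i$; (5) (closing lemma) for every $\epsilon>0$ and $x\in M$ there exist $\delta>0$ and $T_{\min}>0$ such that for every $y\in B(x,\epsilon)$ and $t\ge T_{\min}$ with $d(\varphi_t(y),y)\le\delta$ there exist $z\in B(y,\epsilon)$ and $\tau\in[t-\epsilon,t+\epsilon]$ with $\varphi_\tau(z)=z$ and $d(\varphi_s(z),\varphi_s(y))\le\epsilon$ for all $0\le s\le t$; (6) (expansivity) for every $\nu>0$ there is $\epsilon>0$ such that, for all $x,y\in M$, if there is a continuous map $s:\mathbb R\to\mathbb R$ with $s(0)=0$ and $d(\varphi_t(x),\varphi_{s(t)}(y))\le\epsilon$ for all $t\in\mathbb R$, then $y=\varphi_\tau(x)$ for some $\tau\in[-\nu,\nu]$. **Periodic orbits.** A periodic orbit $\gamma$ is a pair $(\{\varphi_t(x):t\in\mathbb R\},T)$ with $T>0$, $\varphi_T(x)=x$; its period is $\ell(\gamma)=T$ (so multiples of an orbit count as distinct periodic orbits). For $K$ compact, $\mathcal P_K(T_0,T_1)$ is the set of periodic orbits $\gamma$ with $\ell(\gamma)\in[T_0,T_1]$ and $\gamma\cap K\neq\emptyset$. $\tau_K$ is the minimal period of a periodic orbit (possibly multiply covered) with period $\ge1$ intersecting $K$. **Chords.** $B(z,\delta,T)=\{y:d(\varphi_t(z),\varphi_t(y))<\delta\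 \forall t\in[0,T]\}$ is the dynamical ball. For $\eta>0$, $0<T^-<T^+$, $\mathcal C(x,y,\eta,T^-,T^+)=\{z\in B(x,\eta):\varphi_{[T^-,T^+]}(z)\cap B(y,\eta)\ne\emptyset\}$. A set $E$ is $(\delta,T)$-separating if for all distinct $p,q\in E$ there is $t\in[0,T]$ with $d(\varphi_t(p),\varphi_t(q))\ge\delta$. $\mathcal N_{\mathcal C}(x,y,\eta,T^-,T^+,\delta)$ is the maximal cardinality of a $(\delta,T^-)$-separating set $E\subset\mathcal C(x,y,\eta,T^-,T^+)$ such that $\mathcal C(x,y,\eta,T^-,T^+)\subset\bigcup_{z\in E}B(z,\delta,T^-)$. *)

theory Defs
  imports "HOL-Analysis.Analysis"
begin

section \<open>Differentiability classes\<close>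

text \<open>Intended for open sets \<open>S\<close> only, as the derivative is the unrestricted one.\<close>

fun Ck_on :: "nat \<Rightarrow> ('a::euclidean_space \<Rightarrow> 'b::real_normed_vector) \<Rightarrow> 'a set \<Rightarrow> bool" where
  "Ck_on 0 f S \<longleftrightarrow> continuous_on S f"
| "Ck_on (Suc k) f S \<longleftrightarrow>
     (\<forall>x\<in>S. f differentiable (at x)) \<and> (\<forall>v. Ck_on k (\<lambda>x. frechet_derivative f (at x) v) S)"

definition smooth_on :: "('a::euclidean_space \<Rightarrow> 'b::real_normed_vector) \<Rightarrow> 'a set \<Rightarrow> bool" where
  "smooth_on f S \<longleftrightarrow> (\<forall>k. Ck_on k f S)"


section \<open>Riemannian manifolds\<close>

text \<open>
  The manifold is the whole type \<open>'m\<close>, modelled on \<open>'e\<close>. A chart is a pair of its domain and its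
  coordinate map; the values of the coordinate map off the domain are irrelevant.
  A Riemannian metric is given by its coordinate expressions: \<open>g c p v w\<close> is the inner product
  of the two tangent vectors at the point \<open>p\<close> whose coordinates in the chart \<open>c\<close> are \<open>v\<close> and \<open>w\<close>.
\<close>

type_synonym ('m, 'e) chart = "'m set \<times> ('m \<Rightarrow> 'e)"
type_synonym ('m, 'e) metric_tensor = "('m, 'e) chart \<Rightarrow> 'm \<Rightarrow> 'e \<Rightarrow> 'e \<Rightarrow> real"

definition chart_inv :: "('m, 'e) chart \<Rightarrow> 'e \<Rightarrow> 'm" where
  "chart_inv c = inv_into (fst c) (snd c)"

definition transition :: "('m, 'e) chart \<Rightarrow> ('m, 'e) chart \<Rightarrow> 'e \<Rightarrow> 'e" where
  "transition c c' = snd c' \<circ> chart_inv c"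

text \<open>The derivative is one-sided at the endpoints, and continuous up to them.\<close>

definition C1_curve_on ::
  "('m::metric_space, 'e::euclidean_space) chart set \<Rightarrow> (real \<Rightarrow> 'm) \<Rightarrow> real \<Rightarrow> real \<Rightarrow> bool" where
  "C1_curve_on \<A> \<gamma> a b \<longleftrightarrow>
     continuous_on {a..b} \<gamma> \<and>
     (\<forall>c\<in>\<A>. \<exists>D. continuous_on {t\<in>{a..b}. \<gamma> t \<in> fst c} D \<and>
        (\<forall>t\<in>{a..b}. \<gamma> t \<in> fst c \<longrightarrow>
           ((snd c \<circ> \<gamma>) has_vector_derivative D t) (at t within {a..b})))"

definition piecewise_C1_curve ::
  "('m::metric_space, 'e::euclidean_space) chart set \<Rightarrow> (real \<Rightarrow> 'm) \<Rightarrow> bool" where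
  "piecewise_C1_curve \<A> \<gamma> \<longleftrightarrow>
     (\<exists>P. finite P \<and> {0, 1} \<subseteq> P \<and> P \<subseteq> {0..1} \<and>
        (\<forall>a\<in>P. \<forall>b\<in>P. a < b \<and> {a<..<b} \<inter> P = {} \<longrightarrow> C1_curve_on \<A> \<gamma> a b))"

text \<open>The choice of the chart does not matter, by the transformation rule for the metric tensor.\<close>

definition curve_speed ::
  "('m, 'e::euclidean_space) chart set \<Rightarrow> ('m, 'e) metric_tensor \<Rightarrow> (real \<Rightarrow> 'm) \<Rightarrow> real \<Rightarrow> real" where
  "curve_speed \<A> g \<gamma> t =
     (let c = (SOME c. c \<in> \<A> \<and> \<gamma> t \<in> fst c);
          v = vector_derivative (snd c \<circ> \<gamma>) (at t)
      in sqrt (g c (\<gamma> t) v v))"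

definition curve_length ::
  "('m, 'e::euclidean_space) chart set \<Rightarrow> ('m, 'e) metric_tensor \<Rightarrow> (real \<Rightarrow> 'm) \<Rightarrow> real" where
  "curve_length \<A> g \<gamma> = integral {0..1} (curve_speed \<A> g \<gamma>)"

text \<open>
  The metric of the type is required to be the Riemannian distance, and its topology to be the
  manifold topology.
\<close>

locale connected_riemannian_manifold =
  fixes atlas :: "('m::metric_space, 'e::euclidean_space) chart set"
    and g :: "('m, 'e) metric_tensor"
  assumes connected_manifold: "connected (UNIV :: 'm set)"
    and charts_cover: "(\<Union>c\<in>atlas. fst c) = UNIV"
    and chart_open: "c \<in> atlas \<Longrightarrow> open (fst c) \<and> open (snd c ` fst c)"
    and chart_homeomorphism:
      "c \<in> atlas \<Longrightarrow> homeomorphism (fst c) (snd c ` fst c) (snd c) (chart_inv c)"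
    and transition_smooth:
      "\<lbrakk>c \<in> atlas; c' \<in> atlas\<rbrakk> \<Longrightarrow> smooth_on (transition c c') (snd c ` (fst c \<inter> fst c'))"
    and metric_bilinear: "\<lbrakk>c \<in> atlas; p \<in> fst c\<rbrakk> \<Longrightarrow> bilinear (g c p)"
    and metric_symmetric: "\<lbrakk>c \<in> atlas; p \<in> fst c\<rbrakk> \<Longrightarrow> g c p v w = g c p w v"
    and metric_positive: "\<lbrakk>c \<in> atlas; p \<in> fst c; v \<noteq> 0\<rbrakk> \<Longrightarrow> g c p v v > 0"
    and metric_smooth:
      "c \<in> atlas \<Longrightarrow> smooth_on (\<lambda>u. g c (chart_inv c u) v w) (snd c ` fst c)"
    and metric_transform:
      "\<lbrakk>c \<in> atlas; c' \<in> atlas; p \<in> fst c \<inter> fst c'\<rbrakk> \<Longrightarrow>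
         g c p v w = g c' p (frechet_derivative (transition c c') (at (snd c p)) v)
                            (frechet_derivative (transition c c') (at (snd c p)) w)"
    and dist_riemannian:
      "dist x y = Inf {curve_length atlas g \<gamma> | \<gamma>.
                         piecewise_C1_curve atlas \<gamma> \<and> \<gamma> 0 = x \<and> \<gamma> 1 = y}"


section \<open>\<open>H\<close>-flows\<close>

locale C1_flow =
  fixes atlas :: "('m::metric_space, 'e::euclidean_space) chart set"
    and \<phi> :: "real \<Rightarrow> 'm \<Rightarrow> 'm"
  assumes flow_zero: "\<phi> 0 x = x"
    and flow_add: "\<phi> (s + t) x = \<phi> s (\<phi> t x)"
    and flow_continuous: "continuous_on UNIV (\<lambda>(t, x). \<phi> t x)"
    and flow_C1:
      "\<lbrakk>c \<in> atlas; c' \<in> atlas\<rbrakk> \<Longrightarrow>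
         Ck_on 1 (\<lambda>(t, u). snd c' (\<phi> t (chart_inv c u)))
           {(t, u). u \<in> snd c ` fst c \<and> \<phi> t (chart_inv c u) \<in> fst c'}"

locale H_flow = connected_riemannian_manifold atlas g + C1_flow atlas \<phi>
  for atlas :: "('m::metric_space, 'e::euclidean_space) chart set"
    and g :: "('m, 'e) metric_tensor"
    and \<phi> :: "real \<Rightarrow> 'm \<Rightarrow> 'm" +
  assumes complete_manifold: "complete (UNIV :: 'm set)"
    and lipschitz:
      "\<exists>lip. \<forall>x y. \<forall>\<tau>\<in>{-1..1}. dist (\<phi> \<tau> x) (\<phi> \<tau> y) \<le> lip * dist x y"
    and speed_bounds:
      "\<exists>a b. 0 < a \<and> a \<le> b \<and>
         (\<forall>x. \<exists>\<rho>>0. \<forall>t\<in>{-\<rho>..\<rho>}. a * \<bar>t\<bar> \<le> dist x (\<phi> t x) \<and> dist x (\<phi> t x) \<le> b * \<bar>t\<bar>)"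
    and transitivity:
      "\<lbrakk>open U; U \<noteq> {}; open V; V \<noteq> {}; 0 < T\<rbrakk> \<Longrightarrow> \<exists>t\<ge>T. \<phi> t ` U \<inter> V \<noteq> {}"
    and finite_exact_shadowing:
      "\<lbrakk>compact K; 0 < \<delta>; 1 \<le> N\<rbrakk> \<Longrightarrow>
         \<exists>\<eta>>0. \<forall>(x :: nat \<Rightarrow> 'm) (t :: nat \<Rightarrow> real).
           (\<forall>i\<in>{1..N}. x i \<in> K \<and> 0 \<le> t i) \<and>
           (\<forall>i\<in>{1..<N}. dist (\<phi> (t i) (x i)) (x (Suc i)) < \<eta>) \<longrightarrow>
           (\<exists>y. \<forall>i\<in>{1..N}. \<forall>s\<in>{0..t i}.
              dist (\<phi> (s + (\<Sum>j=1..<i. t j)) y) (\<phi> s (x i)) < \<delta>)"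
    and closing_lemma:
      "0 < \<epsilon> \<Longrightarrow>
         \<exists>\<delta>>0. \<exists>Tmin>0. \<forall>y\<in>ball x \<epsilon>. \<forall>t\<ge>Tmin. dist (\<phi> t y) y \<le> \<delta> \<longrightarrow>
           (\<exists>z\<in>ball y \<epsilon>. \<exists>\<tau>\<in>{t - \<epsilon>..t + \<epsilon>}. \<phi> \<tau> z = z \<and>
              (\<forall>s\<in>{0..t}. dist (\<phi> s z) (\<phi> s y) \<le> \<epsilon>))"
    and expansivity:
      "0 < \<nu> \<Longrightarrow>
         \<exists>\<epsilon>>0. \<forall>x y. (\<exists>s :: real \<Rightarrow> real. continuous_on UNIV s \<and> s 0 = 0 \<and>
                         (\<forall>t. dist (\<phi> t x) (\<phi> (s t) y) \<le> \<epsilon>)) \<longrightarrow>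
           (\<exists>\<tau>\<in>{-\<nu>..\<nu>}. y = \<phi> \<tau> x)"


section \<open>Periodic orbits and chords\<close>

text \<open>
  Cardinalities are taken in \<^typ>\<open>ennreal\<close>, so that an infinite set has cardinality \<open>\<infinity>\<close> and not \<open>0\<close>.
\<close>

definition ecard :: "'a set \<Rightarrow> ennreal" where
  "ecard A = emeasure (count_space UNIV) A"

definition periodic_orbits :: "(real \<Rightarrow> 'm \<Rightarrow> 'm) \<Rightarrow> ('m set \<times> real) set" where
  "periodic_orbits \<phi> = {(range (\<lambda>t. \<phi> t x), T) | x T. 0 < T \<and> \<phi> T x = x}"

definition periodic_orbits_meeting ::
  "(real \<Rightarrow> 'm \<Rightarrow> 'm) \<Rightarrow> 'm set \<Rightarrow> real \<Rightarrow> real \<Rightarrow> ('m set \<times> real) set" where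
  "periodic_orbits_meeting \<phi> K T\<^sub>0 T\<^sub>1 =
     {\<gamma> \<in> periodic_orbits \<phi>. snd \<gamma> \<in> {T\<^sub>0..T\<^sub>1} \<and> fst \<gamma> \<inter> K \<noteq> {}}"

definition min_period :: "(real \<Rightarrow> 'm \<Rightarrow> 'm) \<Rightarrow> 'm set \<Rightarrow> real" where
  "min_period \<phi> K =
     (LEAST T. 1 \<le> T \<and> (\<exists>\<gamma>\<in>periodic_orbits \<phi>. snd \<gamma> = T \<and> fst \<gamma> \<inter> K \<noteq> {}))"

definition dynamical_ball ::
  "(real \<Rightarrow> 'm::metric_space \<Rightarrow> 'm) \<Rightarrow> 'm \<Rightarrow> real \<Rightarrow> real \<Rightarrow> 'm set" where
  "dynamical_ball \<phi> z \<delta> T = {y. \<forall>t\<in>{0..T}. dist (\<phi> t z) (\<phi> t y) < \<delta>}"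

definition chords ::
  "(real \<Rightarrow> 'm::metric_space \<Rightarrow> 'm) \<Rightarrow> 'm \<Rightarrow> 'm \<Rightarrow> real \<Rightarrow> real \<Rightarrow> real \<Rightarrow> 'm set" where
  "chords \<phi> x y \<eta> T T' = {z \<in> ball x \<eta>. (\<lambda>t. \<phi> t z) ` {T..T'} \<inter> ball y \<eta> \<noteq> {}}"

definition separating ::
  "(real \<Rightarrow> 'm::metric_space \<Rightarrow> 'm) \<Rightarrow> real \<Rightarrow> real \<Rightarrow> 'm set \<Rightarrow> bool" where
  "separating \<phi> \<delta> T E \<longleftrightarrow>
     (\<forall>p\<in>E. \<forall>q\<in>E. p \<noteq> q \<longrightarrow> (\<exists>t\<in>{0..T}. dist (\<phi> t p) (\<phi> t q) \<ge> \<delta>))"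

definition chord_count ::
  "(real \<Rightarrow> 'm::metric_space \<Rightarrow> 'm) \<Rightarrow> 'm \<Rightarrow> 'm \<Rightarrow> real \<Rightarrow> real \<Rightarrow> real \<Rightarrow> real \<Rightarrow> ennreal" where
  "chord_count \<phi> x y \<eta> T T' \<delta> =
     Sup {ecard E | E. E \<subseteq> chords \<phi> x y \<eta> T T' \<and> separating \<phi> \<delta> T E \<and>
            chords \<phi> x y \<eta> T T' \<subseteq> (\<Union>z\<in>E. dynamical_ball \<phi> z \<delta> T)}"

end

theory Submission
  imports Defs
begin

text \<open>
  The idea is to turn a pair of chords into a closed orbit. Given a chord \<open>p\<close> from near \<open>x\<^sub>0\<close> to near \<open>y\<^sub>0\<close>
  and a chord \<open>q\<close> from near \<open>y\<^sub>0\<close> to near \<open>z\<^sub>0\<close>, transitivity and compactness provide orbit segments, with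
  lengths in a finite set, that lead from the end of \<open>p\<close> to the start of \<open>q\<close>, from the end of \<open>q\<close> to a
  point \<open>u\<close> in the interior of \<open>K\<^sub>0\<close>, from there to a point \<open>w\<close> of a closed orbit of minimal period \<open>\<tau>\<close>,
  and from \<open>w\<close> back to the start of \<open>p\<close> (\<open>finite_transition_times\<close>). Shadowing and the closing lemma
  yield a closed orbit that follows all these segments and \<open>n\<close> turns around the orbit of \<open>w\<close>
  (\<open>periodic_gluing\<close>). It meets \<open>K\<^sub>0\<close> near \<open>u\<close>, and a suitable choice of \<open>n\<close> brings its period into any
  prescribed window of length \<open>5 * \<tau>\<close> that starts late enough.

  Conversely, the pair is almost determined by the closed orbit. If two pairs lead to the same closed
  orbit with the same period, with starting points on it that differ by a flow time of at most \<open>\<theta>\<close>, then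
  the two starting points stay close forever, as the flow moves points at bounded speed
  (\<open>flow_displacement\<close>). So the first chords stay \<open>\<delta>\<close>-close, hence agree if taken from a separated set,
  and so do the second ones if the transition times between the two chords agree as well. There
  are at most about \<open>(T\<^sub>0 + T\<^sub>1 + S + 5 * \<tau>) / \<theta>\<close> positions on a closed orbit, and finitely many
  transition times, which gives the factor \<open>D\<^sub>1 * (T\<^sub>0 + T\<^sub>1 + S)\<close>
  (\<open>separated_pairs_le_periodic_orbits\<close>).

  The compactness arguments take place in a bounded neighbourhood of \<open>K\<close>, which is relatively compact by
  the Hopf--Rinow theorem (\<open>compact_cball\<close>). It is derived from the length structure: an almost
  shortest curve between two points contains points that divide their distance almost exactly in any
  given proportion (\<open>approximate_midpoint\<close>).
\<close>

section \<open>Piecewise differentiable curves\<close>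

lemma C1_curve_on_affine:
  assumes "C1_curve_on \<A> \<gamma> a b" and "0 < k" and "a \<le> l + k * a'" and "l + k * b' \<le> b"
  shows "C1_curve_on \<A> (\<lambda>t. \<gamma> (l + k * t)) a' b'"
proof -
  define h where "h = (\<lambda>t. l + k * t)"
  have hin: "h t \<in> {a..b}" if t: "t \<in> {a'..b'}" for t
  proof -
    from t have "k * a' \<le> k * t" "k * t \<le> k * b'" using \<open>0 < k\<close> by auto
    then show ?thesis using assms(3,4) by (auto simp: h_def)
  qed
  then have h: "h ` {a'..b'} \<subseteq> {a..b}" by blast
  have hc: "continuous_on S h" for S by (auto simp: h_def intro!: continuous_intros)
  show ?thesis unfolding C1_curve_on_def
  proof (intro conjI ballI)
    show "continuous_on {a'..b'} (\<lambda>t. \<gamma> (l + k * t))"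
      using continuous_on_compose2[OF _ hc h, of \<gamma>] assms(1) unfolding C1_curve_on_def h_def by auto
    fix c assume "c \<in> \<A>"
    then obtain D where D: "continuous_on {t\<in>{a..b}. \<gamma> t \<in> fst c} D"
      "\<And>t. t \<in> {a..b} \<Longrightarrow> \<gamma> t \<in> fst c \<Longrightarrow> ((snd c \<circ> \<gamma>) has_vector_derivative D t) (at t within {a..b})"
      using assms(1) unfolding C1_curve_on_def by meson
    have "continuous_on {t\<in>{a'..b'}. \<gamma> (l + k * t) \<in> fst c} (\<lambda>t. k *\<^sub>R D (h t))"
      by (intro continuous_intros continuous_on_compose2[OF D(1) hc]) (use hin in \<open>auto simp: h_def\<close>)
    moreover have "((snd c \<circ> (\<lambda>t. \<gamma> (l + k * t))) has_vector_derivative k *\<^sub>R D (h t)) (at t within {a'..b'})"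
      if t: "t \<in> {a'..b'}" "\<gamma> (l + k * t) \<in> fst c" for t
    proof -
      have 1: "(h has_vector_derivative k) (at t within {a'..b'})"
        unfolding h_def by (auto intro!: derivative_eq_intros)
      have "((snd c \<circ> \<gamma>) has_vector_derivative D (h t)) (at (h t) within h ` {a'..b'})"
        using D(2)[of "h t"] t hin[of t] h by (auto simp: h_def intro: has_vector_derivative_within_subset)
      from vector_diff_chain_within[OF 1 this] show ?thesis by (simp add: h_def o_def)
    qed
    ultimately show "\<exists>D. continuous_on {t \<in> {a'..b'}. \<gamma> (l + k * t) \<in> fst c} D \<and>
        (\<forall>t\<in>{a'..b'}. \<gamma> (l + k * t) \<in> fst c \<longrightarrow>
          ((snd c \<circ> (\<lambda>t. \<gamma> (l + k * t))) has_vector_derivative D t) (at t within {a'..b'}))"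
      by blast
  qed
qed

lemma C1_curve_on_subinterval:
  assumes "C1_curve_on \<A> \<gamma> a b" and "a \<le> a'" and "b' \<le> b"
  shows "C1_curve_on \<A> \<gamma> a' b'"
  using C1_curve_on_affine[OF assms(1), of 1 0 a' b'] assms(2,3) by simp

lemma C1_curve_on_cong:
  assumes "C1_curve_on \<A> \<gamma> a b" and eq: "\<And>t. t \<in> {a..b} \<Longrightarrow> \<gamma> t = \<gamma>' t"
  shows "C1_curve_on \<A> \<gamma>' a b"
  unfolding C1_curve_on_def
proof (intro conjI ballI)
  show "continuous_on {a..b} \<gamma>'"
    using assms(1) continuous_on_cong[of "{a..b}" "{a..b}" \<gamma> \<gamma>'] eq unfolding C1_curve_on_def by auto
  fix c assume "c \<in> \<A>"
  then obtain D where D: "continuous_on {t\<in>{a..b}. \<gamma> t \<in> fst c} D"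
    "\<And>t. t \<in> {a..b} \<Longrightarrow> \<gamma> t \<in> fst c \<Longrightarrow> ((snd c \<circ> \<gamma>) has_vector_derivative D t) (at t within {a..b})"
    using assms(1) unfolding C1_curve_on_def by meson
  have "{t\<in>{a..b}. \<gamma> t \<in> fst c} = {t\<in>{a..b}. \<gamma>' t \<in> fst c}" using eq by auto
  moreover have "((snd c \<circ> \<gamma>') has_vector_derivative D t) (at t within {a..b})"
    if "t \<in> {a..b}" "\<gamma>' t \<in> fst c" for t
    by (rule has_vector_derivative_transform[OF that(1) _ D(2)[OF that(1)]]) (use that eq in auto)
  ultimately show "\<exists>D. continuous_on {t\<in>{a..b}. \<gamma>' t \<in> fst c} D \<and>
     (\<forall>t\<in>{a..b}. \<gamma>' t \<in> fst c \<longrightarrow> ((snd c \<circ> \<gamma>') has_vector_derivative D t) (at t within {a..b}))"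
    using D(1) by auto
qed

text \<open>
  In this form the condition is visibly stable under restriction and concatenation: the exceptional
  set is an arbitrary finite one, and all the intervals that avoid it are considered.
\<close>

lemma piecewise_C1_curve_iff:
  "piecewise_C1_curve \<A> \<gamma> \<longleftrightarrow>
     (\<exists>P. finite P \<and> (\<forall>a b. 0 \<le> a \<and> a < b \<and> b \<le> 1 \<and> {a<..<b} \<inter> P = {} \<longrightarrow> C1_curve_on \<A> \<gamma> a b))"
  (is "_ \<longleftrightarrow> ?R")
proof
  assume "piecewise_C1_curve \<A> \<gamma>"
  then obtain P where P: "finite P" "{0,1} \<subseteq> P" "P \<subseteq> {0..1}"
    "\<And>a b. a \<in> P \<Longrightarrow> b \<in> P \<Longrightarrow> a < b \<Longrightarrow> {a<..<b} \<inter> P = {} \<Longrightarrow> C1_curve_on \<A> \<gamma> a b"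
    unfolding piecewise_C1_curve_def by meson
  have "C1_curve_on \<A> \<gamma> a b" if ab: "0 \<le> a" "a < b" "b \<le> 1" "{a<..<b} \<inter> P = {}" for a b
  proof -
    define a0 where "a0 = Max (P \<inter> {..a})"
    define b0 where "b0 = Min (P \<inter> {b..})"
    have f: "finite (P \<inter> {..a})" "finite (P \<inter> {b..})" using P(1) by auto
    have ne: "P \<inter> {..a} \<noteq> {}" "P \<inter> {b..} \<noteq> {}" using P(2) ab by auto
    have a0: "a0 \<in> P" "a0 \<le> a" "\<And>t. t \<in> P \<Longrightarrow> t \<le> a \<Longrightarrow> t \<le> a0"
      using Max_in[OF f(1) ne(1)] Max_ge[OF f(1)] unfolding a0_def by auto
    have b0: "b0 \<in> P" "b \<le> b0" "\<And>t. t \<in> P \<Longrightarrow> b \<le> t \<Longrightarrow> b0 \<le> t"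
      using Min_in[OF f(2) ne(2)] Min_le[OF f(2)] unfolding b0_def by auto
    have "{a0<..<b0} \<inter> P = {}"
    proof (rule ccontr)
      assume "{a0<..<b0} \<inter> P \<noteq> {}"
      then obtain t where t: "t \<in> P" "a0 < t" "t < b0" by auto
      then have "a < t" "t < b" using a0(3)[of t] b0(3)[of t] by force+
      then show False using ab(4) t by auto
    qed
    then have "C1_curve_on \<A> \<gamma> a0 b0" using P(4) a0 b0 ab by auto
    then show ?thesis using C1_curve_on_subinterval a0 b0 by blast
  qed
  then show ?R using P(1) by blast
next
  assume ?R
  then obtain P where P: "finite P"
    "\<And>a b. 0 \<le> a \<Longrightarrow> a < b \<Longrightarrow> b \<le> 1 \<Longrightarrow> {a<..<b} \<inter> P = {} \<Longrightarrow> C1_curve_on \<A> \<gamma> a b" by blast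
  have "C1_curve_on \<A> \<gamma> a b"
    if "a \<in> P \<inter> {0..1} \<union> {0,1}" "b \<in> P \<inter> {0..1} \<union> {0,1}" "a < b" "{a<..<b} \<inter> (P \<inter> {0..1} \<union> {0,1}) = {}" for a b
    using that by (intro P(2)) auto
  then show "piecewise_C1_curve \<A> \<gamma>"
    unfolding piecewise_C1_curve_def using P(1) by (intro exI[of _ "P \<inter> {0..1} \<union> {0,1}"]) auto
qed

lemma piecewise_C1_curve_subcurve:
  assumes "piecewise_C1_curve \<A> \<gamma>" and l: "0 \<le> l" "l < m" "m \<le> 1"
  shows "piecewise_C1_curve \<A> (\<lambda>t. \<gamma> (l + (m - l) * t))"
proof -
  obtain P where P: "finite P"
    "\<And>a b. 0 \<le> a \<Longrightarrow> a < b \<Longrightarrow> b \<le> 1 \<Longrightarrow> {a<..<b} \<inter> P = {} \<Longrightarrow> C1_curve_on \<A> \<gamma> a b"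
    using assms(1) unfolding piecewise_C1_curve_iff by blast
  define h where "h t = l + (m - l) * t" for t
  have mono: "h a < h b" if "a < b" for a b using that l by (simp add: h_def)
  have inj: "inj h" using l by (auto simp: inj_def h_def)
  have "C1_curve_on \<A> (\<lambda>t. \<gamma> (h t)) a b"
    if ab: "0 \<le> a" "a < b" "b \<le> 1" "{a<..<b} \<inter> h -` P = {}" for a b
  proof -
    have "{h a<..<h b} \<inter> P = {}"
    proof (rule ccontr)
      assume "{h a<..<h b} \<inter> P \<noteq> {}"
      then obtain t where t: "t \<in> P" "h a < t" "t < h b" by auto
      define s where "s = (t - l) / (m - l)"
      have hs: "h s = t" using l by (simp add: h_def s_def)
      have "a < s" "s < b" using t(2,3) hs mono[of s a] mono[of b s] by (metis linorder_neqE_linordered_idom less_asym less_irrefl)+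
      then show False using ab(4) t(1) hs by auto
    qed
    moreover have "0 \<le> h a" using l ab by (simp add: h_def)
    moreover have "h b \<le> 1"
    proof -
      have "(m - l) * b \<le> m - l" using ab l by (simp add: mult_left_le)
      then show ?thesis using l unfolding h_def by linarith
    qed
    ultimately have "C1_curve_on \<A> \<gamma> (h a) (h b)" using P(2) mono ab by blast
    then show ?thesis unfolding h_def by (rule C1_curve_on_affine) (use l in auto)
  qed
  moreover have "finite (h -` P)" by (rule finite_vimageI[OF P(1) inj])
  ultimately show ?thesis unfolding piecewise_C1_curve_iff h_def by blast
qed

lemma piecewise_C1_curve_join:
  assumes "piecewise_C1_curve \<A> \<gamma>" and "piecewise_C1_curve \<A> \<gamma>'" and ends: "\<gamma> 1 = \<gamma>' 0"
  shows "piecewise_C1_curve \<A> (\<lambda>t. if t \<le> 1/2 then \<gamma> (2 * t) else \<gamma>' (2 * t - 1))"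
    (is "piecewise_C1_curve \<A> ?\<gamma>")
proof -
  obtain P where P: "finite P"
    "\<And>a b. 0 \<le> a \<Longrightarrow> a < b \<Longrightarrow> b \<le> 1 \<Longrightarrow> {a<..<b} \<inter> P = {} \<Longrightarrow> C1_curve_on \<A> \<gamma> a b"
    using assms(1) unfolding piecewise_C1_curve_iff by blast
  obtain Q where Q: "finite Q"
    "\<And>a b. 0 \<le> a \<Longrightarrow> a < b \<Longrightarrow> b \<le> 1 \<Longrightarrow> {a<..<b} \<inter> Q = {} \<Longrightarrow> C1_curve_on \<A> \<gamma>' a b"
    using assms(2) unfolding piecewise_C1_curve_iff by blast
  define R where "R = insert (1/2) ((\<lambda>t. t / 2) ` P \<union> (\<lambda>t. (t + 1) / 2) ` Q)"
  have "C1_curve_on \<A> ?\<gamma> a b" if ab: "0 \<le> a" "a < b" "b \<le> 1" "{a<..<b} \<inter> R = {}" for a b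
  proof -
    have d: "1/2 \<notin> {a<..<b}" using ab(4) unfolding R_def by auto
    have dP: "{2*a<..<2*b} \<inter> P = {}"
    proof (rule ccontr)
      assume "\<not> ?thesis"
      then obtain t where "t \<in> P" "2*a < t" "t < 2*b" by auto
      then have "t/2 \<in> {a<..<b} \<inter> R" unfolding R_def by auto
      then show False using ab(4) by auto
    qed
    have dQ: "{2*a-1<..<2*b-1} \<inter> Q = {}"
    proof (rule ccontr)
      assume "\<not> ?thesis"
      then obtain t where "t \<in> Q" "2*a-1 < t" "t < 2*b-1" by auto
      then have "(t+1)/2 \<in> {a<..<b} \<inter> R" unfolding R_def by auto
      then show False using ab(4) by auto
    qed
    consider "b \<le> 1/2" | "1/2 \<le> a" using d by fastforce
    then show ?thesis
    proof cases
      case 1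
      have "C1_curve_on \<A> \<gamma> (2*a) (2*b)" using P(2)[OF _ _ _ dP] ab 1 by auto
      then have "C1_curve_on \<A> (\<lambda>t. \<gamma> (0 + 2 * t)) a b" by (rule C1_curve_on_affine) auto
      then show ?thesis by (rule C1_curve_on_cong) (use 1 in auto)
    next
      case 2
      have "C1_curve_on \<A> \<gamma>' (2*a-1) (2*b-1)" using Q(2)[OF _ _ _ dQ] ab 2 by auto
      then have "C1_curve_on \<A> (\<lambda>t. \<gamma>' (-1 + 2 * t)) a b" by (rule C1_curve_on_affine) auto
      then show ?thesis
      proof (rule C1_curve_on_cong)
        fix t assume "t \<in> {a..b}"
        then have "t \<le> 1/2 \<Longrightarrow> t = 1/2" using 2 by auto
        then show "\<gamma>' (-1 + 2 * t) = ?\<gamma> t" using ends by (auto simp: algebra_simps)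
      qed
    qed
  qed
  moreover have "finite R" unfolding R_def using P(1) Q(1) by auto
  ultimately show ?thesis unfolding piecewise_C1_curve_iff by blast
qed

section \<open>Length of curves and Riemannian distance\<close>

context connected_riemannian_manifold
begin

lemma metric_nonneg:
  assumes "c \<in> atlas" and "p \<in> fst c"
  shows "0 \<le> g c p v v"
proof (cases "v = 0")
  case True
  then show ?thesis using bilinear_lzero[OF metric_bilinear[OF assms]] by simp
next
  case False
  then show ?thesis using metric_positive[OF assms] by (simp add: less_imp_le)
qed

lemma metric_scale:
  assumes "c \<in> atlas" and "p \<in> fst c"
  shows "g c p (k *\<^sub>R v) (k *\<^sub>R v) = k\<^sup>2 * g c p v v"
  using metric_bilinear[OF assms] by (simp add: bilinear_lmul bilinear_rmul power2_eq_square)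

text \<open>The chart in which \<open>curve_speed\<close> evaluates the speed of a curve at a given point.\<close>

definition chart_at :: "'m \<Rightarrow> ('m, 'e) chart" where
  "chart_at p = (SOME c. c \<in> atlas \<and> p \<in> fst c)"

lemma chart_at: "chart_at p \<in> atlas" "p \<in> fst (chart_at p)"
proof -
  have "\<exists>c. c \<in> atlas \<and> p \<in> fst c" using charts_cover by blast
  from someI_ex[OF this] show "chart_at p \<in> atlas" "p \<in> fst (chart_at p)" unfolding chart_at_def by auto
qed

lemma curve_speed_eq:
  "curve_speed atlas g \<gamma> t =
     sqrt (g (chart_at (\<gamma> t)) (\<gamma> t) (vector_derivative (snd (chart_at (\<gamma> t)) \<circ> \<gamma>) (at t))
                                  (vector_derivative (snd (chart_at (\<gamma> t)) \<circ> \<gamma>) (at t)))"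
  unfolding curve_speed_def chart_at_def Let_def by simp

lemma curve_speed_nonneg: "0 \<le> curve_speed atlas g \<gamma> t"
  unfolding curve_speed_eq using metric_nonneg chart_at by simp

lemma C1_curve_interior_derivative:
  assumes "C1_curve_on \<A> \<gamma> a b" and "c \<in> \<A>" and "t \<in> {a<..<b}" and "\<gamma> t \<in> fst c"
  obtains v where "((snd c \<circ> \<gamma>) has_vector_derivative v) (at t)"
proof -
  obtain D where D:
    "\<And>t. t \<in> {a..b} \<Longrightarrow> \<gamma> t \<in> fst c \<Longrightarrow> ((snd c \<circ> \<gamma>) has_vector_derivative D t) (at t within {a..b})"
    using assms(1,2) unfolding C1_curve_on_def by meson
  show ?thesis
    by (rule that[of "D t"]) (use D[of t] assms(3,4) at_within_Icc_at[of a t b] in auto)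
qed

lemma curve_speed_affine:
  assumes "C1_curve_on atlas \<gamma> a b" and "0 < k" and "l + k * t \<in> {a<..<b}"
  shows "curve_speed atlas g (\<lambda>t. \<gamma> (l + k * t)) t = k * curve_speed atlas g \<gamma> (l + k * t)"
proof -
  define c where "c = chart_at (\<gamma> (l + k * t))"
  have c: "c \<in> atlas" "\<gamma> (l + k * t) \<in> fst c" using chart_at unfolding c_def by auto
  obtain v where v: "((snd c \<circ> \<gamma>) has_vector_derivative v) (at (l + k * t))"
    using C1_curve_interior_derivative[OF assms(1) c(1) assms(3) c(2)] .
  have "((\<lambda>t. l + k * t) has_vector_derivative k) (at t)"
    by (auto intro!: derivative_eq_intros)
  from vector_diff_chain_at[OF this v]
  have "((snd c \<circ> (\<lambda>t. \<gamma> (l + k * t))) has_vector_derivative k *\<^sub>R v) (at t)" by (simp add: o_def)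
  then show ?thesis
    unfolding curve_speed_eq c_def[symmetric]
    using vector_derivative_at[OF v] \<open>0 < k\<close>
    by (simp add: vector_derivative_at metric_scale[OF c] real_sqrt_mult)
qed

lemma transition_has_derivative:
  assumes "c \<in> atlas" "c' \<in> atlas" "p \<in> fst c \<inter> fst c'"
  shows "(transition c c' has_derivative frechet_derivative (transition c c') (at (snd c p))) (at (snd c p))"
proof -
  have "Ck_on 1 (transition c c') (snd c ` (fst c \<inter> fst c'))"
    using transition_smooth[OF assms(1,2)] unfolding smooth_on_def by blast
  then have "transition c c' differentiable (at (snd c p))" using assms(3) by auto
  then show ?thesis using frechet_derivative_works by blast
qed

text \<open>
  The speed can be computed in any chart, hence agrees inside a smooth piece with a function that is
  continuous up to the endpoints.
\<close>

lemma curve_speed_integrable_in_chart: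
  assumes C1: "C1_curve_on atlas \<gamma> a b" and c: "c \<in> atlas" and im: "\<gamma> ` {a..b} \<subseteq> fst c"
  shows "curve_speed atlas g \<gamma> integrable_on {a..b}"
proof -
  obtain D where D0: "continuous_on {t\<in>{a..b}. \<gamma> t \<in> fst c} D"
    and D1: "\<And>t. t \<in> {a..b} \<Longrightarrow> \<gamma> t \<in> fst c \<Longrightarrow> ((snd c \<circ> \<gamma>) has_vector_derivative D t) (at t within {a..b})"
    using C1 c unfolding C1_curve_on_def by meson
  have "{t\<in>{a..b}. \<gamma> t \<in> fst c} = {a..b}" using im by auto
  then have Dc: "continuous_on {a..b} D" using D0 by simp
  have \<gamma>c: "continuous_on {a..b} \<gamma>" using C1 unfolding C1_curve_on_def by auto
  have hom: "homeomorphism (fst c) (snd c ` fst c) (snd c) (chart_inv c)" by (rule chart_homeomorphism[OF c])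
  have inv: "chart_inv c (snd c p) = p" if "p \<in> fst c" for p using hom that unfolding homeomorphism_def by auto
  define h where "h t = g c (\<gamma> t) (D t) (D t)" for t
  have hc: "continuous_on {a..b} h"
  proof -
    have gc: "continuous_on {a..b} (\<lambda>t. g c (\<gamma> t) v w)" for v w
    proof -
      have "Ck_on 0 (\<lambda>u. g c (chart_inv c u) v w) (snd c ` fst c)"
        using metric_smooth[OF c] unfolding smooth_on_def by blast
      then have 1: "continuous_on (snd c ` fst c) (\<lambda>u. g c (chart_inv c u) v w)" by simp
      have "continuous_on (fst c) (snd c)" using hom unfolding homeomorphism_def by auto
      then have 2: "continuous_on {a..b} (\<lambda>t. snd c (\<gamma> t))" using \<gamma>c im by (rule continuous_on_compose2)
      have "continuous_on {a..b} (\<lambda>t. g c (chart_inv c (snd c (\<gamma> t))) v w)"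
        by (rule continuous_on_compose2[OF 1 2]) (use im in auto)
      then show ?thesis by (rule continuous_on_eq) (use im inv in \<open>simp add: image_subset_iff\<close>)
    qed
    have "continuous_on {a..b} (\<lambda>t. \<Sum>(i,j)\<in>Basis \<times> Basis. (D t \<bullet> i) * (D t \<bullet> j) * g c (\<gamma> t) i j)"
      unfolding case_prod_beta by (intro continuous_intros Dc gc)
    then show ?thesis
    proof (rule continuous_on_eq)
      fix t assume "t \<in> {a..b}"
      then have "bilinear (g c (\<gamma> t))" using metric_bilinear[OF c] im by (simp add: image_subset_iff)
      from bilinear_sum[OF this, of "\<lambda>i. (D t \<bullet> i) *\<^sub>R i" Basis "\<lambda>i. (D t \<bullet> i) *\<^sub>R i" Basis]
      show "(\<Sum>(i,j)\<in>Basis \<times> Basis. (D t \<bullet> i) * (D t \<bullet> j) * g c (\<gamma> t) i j) = h t"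
        unfolding h_def euclidean_representation using \<open>bilinear (g c (\<gamma> t))\<close>
        by (simp add: bilinear_lmul bilinear_rmul case_prod_beta mult.assoc)
    qed
  qed
  have eq: "curve_speed atlas g \<gamma> t = sqrt (h t)" if t: "t \<in> {a..b} - {a, b}" for t
  proof -
    define c' where "c' = chart_at (\<gamma> t)"
    have c': "c' \<in> atlas" "\<gamma> t \<in> fst c'" using chart_at unfolding c'_def by auto
    have tab: "t \<in> {a<..<b}" and p: "\<gamma> t \<in> fst c" using t im by auto
    obtain v where v: "((snd c' \<circ> \<gamma>) has_vector_derivative v) (at t)"
      using C1_curve_interior_derivative[OF C1 c'(1) tab c'(2)] .
    define F where "F = frechet_derivative (transition c c') (at (snd c (\<gamma> t)))"
    have F: "(transition c c' has_derivative F) (at ((snd c \<circ> \<gamma>) t))"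
      using transition_has_derivative[OF c c'(1)] p c'(2) unfolding F_def by auto
    have "((snd c \<circ> \<gamma>) has_vector_derivative D t) (at t)"
      using D1[of t] tab p at_within_Icc_at[of a t b] by auto
    then have "((snd c \<circ> \<gamma>) has_derivative (\<lambda>h. h *\<^sub>R D t)) (at t)" unfolding has_vector_derivative_def .
    from diff_chain_at[OF this F]
    have "((transition c c' \<circ> (snd c \<circ> \<gamma>)) has_derivative (F \<circ> (\<lambda>h. h *\<^sub>R D t))) (at t)" .
    moreover have "F \<circ> (\<lambda>h. h *\<^sub>R D t) = (\<lambda>h. h *\<^sub>R F (D t))"
      using linear_scale[OF has_derivative_linear[OF F]] by (auto simp: o_def)
    ultimately have "((transition c c' \<circ> (snd c \<circ> \<gamma>)) has_vector_derivative F (D t)) (at t)"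
      unfolding has_vector_derivative_def by simp
    then have "((snd c' \<circ> \<gamma>) has_vector_derivative F (D t)) (at t)"
      by (rule has_vector_derivative_transform_within_open[where S = "{a<..<b}"])
        (use tab im inv in \<open>auto simp: transition_def image_subset_iff\<close>)
    then have "v = F (D t)" using v vector_derivative_at by blast
    moreover have "g c (\<gamma> t) (D t) (D t) = g c' (\<gamma> t) (F (D t)) (F (D t))"
      unfolding F_def by (rule metric_transform[OF c c'(1)]) (use p c' in auto)
    ultimately show ?thesis
      unfolding curve_speed_eq c'_def[symmetric] h_def using vector_derivative_at[OF v] by simp
  qed
  have "(\<lambda>t. sqrt (h t)) integrable_on {a..b}"
    by (rule integrable_continuous_real) (intro continuous_intros hc)
  then show ?thesis by (rule integrable_spike_finite[of "{a,b}", rotated 2]) (use eq in auto)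
qed

lemma curve_speed_locally_integrable:
  assumes C1: "C1_curve_on atlas \<gamma> a b" and x: "x \<in> {a..b}"
  shows "\<exists>d>0. \<forall>u v. u \<le> v \<and> {u..v} \<subseteq> {a..b} \<inter> ball x d \<longrightarrow> curve_speed atlas g \<gamma> integrable_on {u..v}"
proof -
  define c where "c = chart_at (\<gamma> x)"
  have c: "c \<in> atlas" "\<gamma> x \<in> fst c" using chart_at unfolding c_def by auto
  have "open (fst c)" using chart_open[OF c(1)] by simp
  then obtain e where e: "e > 0" "ball (\<gamma> x) e \<subseteq> fst c" using c(2) openE by blast
  have "continuous_on {a..b} \<gamma>" using C1 unfolding C1_curve_on_def by auto
  then obtain d where d: "d > 0" "\<And>t. t \<in> {a..b} \<Longrightarrow> dist t x < d \<Longrightarrow> dist (\<gamma> t) (\<gamma> x) < e"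
    using x e(1) unfolding continuous_on_iff by meson
  have "curve_speed atlas g \<gamma> integrable_on {u..v}" if "u \<le> v" "{u..v} \<subseteq> {a..b} \<inter> ball x d" for u v
  proof (rule curve_speed_integrable_in_chart[OF _ c(1)])
    have "u \<in> {a..b}" "v \<in> {a..b}" using that by auto
    then show "C1_curve_on atlas \<gamma> u v" by (intro C1_curve_on_subinterval[OF C1]) auto
    show "\<gamma> ` {u..v} \<subseteq> fst c"
    proof safe
      fix t assume "t \<in> {u..v}"
      then have "t \<in> {a..b}" "dist t x < d" using that(2) by (auto simp: dist_commute)
      then have "\<gamma> t \<in> ball (\<gamma> x) e" using d(2)[of t] by (simp add: dist_commute)
      then show "\<gamma> t \<in> fst c" using e(2) by blast
    qed
  qed
  then show ?thesis using d(1) by blast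
qed

lemma curve_speed_integrable:
  assumes "piecewise_C1_curve atlas \<gamma>"
  shows "curve_speed atlas g \<gamma> integrable_on {0..1}"
proof -
  obtain P where P: "finite P"
    "\<And>a b. 0 \<le> a \<Longrightarrow> a < b \<Longrightarrow> b \<le> 1 \<Longrightarrow> {a<..<b} \<inter> P = {} \<Longrightarrow> C1_curve_on atlas \<gamma> a b"
    using assms unfolding piecewise_C1_curve_iff by blast
  have "\<exists>d>0. \<forall>u v. x \<in> {u..v} \<and> {u..v} \<subseteq> ball x d \<and> {u..v} \<subseteq> {0..1} \<longrightarrow>
          curve_speed atlas g \<gamma> integrable_on {u..v}" if x: "x \<in> {0..1}" for x
  proof -
    obtain e where e: "e > 0" "\<And>t. t \<in> P \<Longrightarrow> t \<noteq> x \<Longrightarrow> e \<le> dist x t"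
      using finite_set_avoid[OF P(1), of x] by (auto simp: dist_commute)
    define \<alpha> where "\<alpha> = max 0 (x - e)"
    define \<beta> where "\<beta> = min 1 (x + e)"
    have \<alpha>\<beta>: "0 \<le> \<alpha>" "\<alpha> \<le> x" "x \<le> \<beta>" "\<beta> \<le> 1" using x e(1) by (auto simp: \<alpha>_def \<beta>_def)
    have gap: "t \<notin> P" if "\<alpha> < t" "t < \<beta>" "t \<noteq> x" for t
      using e(2)[of t] that by (auto simp: \<alpha>_def \<beta>_def dist_real_def)
    have left: "\<exists>d>0. \<forall>u. u \<le> x \<and> {u..x} \<subseteq> {\<alpha>..x} \<inter> ball x d \<longrightarrow> curve_speed atlas g \<gamma> integrable_on {u..x}"
    proof (cases "\<alpha> = x")
      case True
      then have "u = x" if "u \<le> x" "{u..x} \<subseteq> {\<alpha>..x}" for u using that by auto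
      then show ?thesis
        using integrable_on_refl[of "curve_speed atlas g \<gamma>" x] unfolding cbox_interval
        by (intro exI[of _ 1]) (metis Int_subset_iff zero_less_one)
    next
      case False
      then have "C1_curve_on atlas \<gamma> \<alpha> x" using \<alpha>\<beta> gap by (intro P(2)) force+
      from curve_speed_locally_integrable[OF this, of x] show ?thesis using \<alpha>\<beta> by auto
    qed
    have right: "\<exists>d>0. \<forall>v. x \<le> v \<and> {x..v} \<subseteq> {x..\<beta>} \<inter> ball x d \<longrightarrow> curve_speed atlas g \<gamma> integrable_on {x..v}"
    proof (cases "\<beta> = x")
      case True
      then have "v = x" if "x \<le> v" "{x..v} \<subseteq> {x..\<beta>}" for v using that by auto
      then show ?thesis
        using integrable_on_refl[of "curve_speed atlas g \<gamma>" x] unfolding cbox_interval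
        by (intro exI[of _ 1]) (metis Int_subset_iff zero_less_one)
    next
      case False
      then have "C1_curve_on atlas \<gamma> x \<beta>" using \<alpha>\<beta> gap by (intro P(2)) force+
      from curve_speed_locally_integrable[OF this, of x] show ?thesis using \<alpha>\<beta> by auto
    qed
    obtain d1 d2 where d: "d1 > 0" "d2 > 0"
      "\<And>u. u \<le> x \<Longrightarrow> {u..x} \<subseteq> {\<alpha>..x} \<inter> ball x d1 \<Longrightarrow> curve_speed atlas g \<gamma> integrable_on {u..x}"
      "\<And>v. x \<le> v \<Longrightarrow> {x..v} \<subseteq> {x..\<beta>} \<inter> ball x d2 \<Longrightarrow> curve_speed atlas g \<gamma> integrable_on {x..v}"
      using left right by blast
    have "curve_speed atlas g \<gamma> integrable_on {u..v}"
      if uv: "x \<in> {u..v}" "{u..v} \<subseteq> ball x (min e (min d1 d2))" "{u..v} \<subseteq> {0..1}" for u v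
    proof (rule Henstock_Kurzweil_Integration.integrable_combine[of u x v])
      have b: "dist x t < e" "dist x t < d1" "dist x t < d2" "0 \<le> t" "t \<le> 1" if "t \<in> {u..v}" for t
        using uv(2,3) that by (auto dest!: subsetD)
      have "t \<in> {\<alpha>..\<beta>}" if "t \<in> {u..v}" for t
        using b(1,4,5)[OF that] by (auto simp: \<alpha>_def \<beta>_def dist_real_def)
      then show "curve_speed atlas g \<gamma> integrable_on {u..x}" "curve_speed atlas g \<gamma> integrable_on {x..v}"
        using uv(1) b by (auto intro!: d(3,4))
    qed (use uv(1) in auto)
    then show ?thesis using e(1) d(1,2) by (intro exI[of _ "min e (min d1 d2)"]) auto
  qed
  then show ?thesis using integrable_on_little_subintervals[of 0 1 "curve_speed atlas g \<gamma>"] by simp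
qed

lemma curve_length_subcurve:
  assumes pw: "piecewise_C1_curve atlas \<gamma>" and l: "0 \<le> l" "l < m" "m \<le> 1"
  shows "curve_length atlas g (\<lambda>t. \<gamma> (l + (m - l) * t)) = integral {l..m} (curve_speed atlas g \<gamma>)"
proof -
  define f where "f = curve_speed atlas g \<gamma>"
  obtain P where P: "finite P"
    "\<And>a b. 0 \<le> a \<Longrightarrow> a < b \<Longrightarrow> b \<le> 1 \<Longrightarrow> {a<..<b} \<inter> P = {} \<Longrightarrow> C1_curve_on atlas \<gamma> a b"
    using pw unfolding piecewise_C1_curve_iff by blast
  define h where "h t = l + (m - l) * t" for t
  have inj: "inj h" using l by (auto simp: inj_def h_def)
  have "f integrable_on {l..m}"
    using curve_speed_integrable[OF pw] l unfolding f_def by (auto intro: integrable_on_subinterval)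
  then have "(f has_integral integral {l..m} f) (cbox l m)" by (simp add: integrable_integral)
  from has_integral_affinity'[OF this, of "m - l" l]
  have "((\<lambda>t. f (h t)) has_integral integral {l..m} f / (m - l)) {0..1}"
    using l by (simp add: h_def algebra_simps divide_simps)
  from has_integral_mult_right[OF this, of "m - l"]
  have 1: "((\<lambda>t. (m - l) * f (h t)) has_integral integral {l..m} f) {0..1}" using l by simp
  have "finite ({0, 1} \<union> h -` P)" using finite_vimageI[OF P(1) inj] by simp
  moreover have "curve_speed atlas g (\<lambda>t. \<gamma> (l + (m - l) * t)) t = (m - l) * f (h t)"
    if t: "t \<in> {0..1} - ({0, 1} \<union> h -` P)" for t
  proof -
    have ht: "0 < h t" "h t < 1" "h t \<notin> P"
    proof -
      have "0 < (m - l) * t" "(m - l) * t < (m - l)" using l t by auto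
      then show "0 < h t" "h t < 1" using l unfolding h_def by linarith+
      show "h t \<notin> P" using t by simp
    qed
    obtain e where e: "e > 0" "\<And>s. s \<in> P \<Longrightarrow> s \<noteq> h t \<Longrightarrow> e \<le> dist (h t) s"
      using finite_set_avoid[OF P(1), of "h t"] by (auto simp: dist_commute)
    define \<alpha> where "\<alpha> = max 0 (h t - e)"
    define \<beta> where "\<beta> = min 1 (h t + e)"
    have "s \<notin> P" if "\<alpha> < s" "s < \<beta>" for s
    proof
      assume "s \<in> P"
      then have "e \<le> dist (h t) s" using e(2)[of s] ht(3) by metis
      then show False using that by (auto simp: \<alpha>_def \<beta>_def dist_real_def)
    qed
    moreover have ab: "0 \<le> \<alpha>" "\<alpha> < h t" "h t < \<beta>" "\<beta> \<le> 1"
      using ht e(1) by (auto simp: \<alpha>_def \<beta>_def)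
    ultimately have "C1_curve_on atlas \<gamma> \<alpha> \<beta>" by (intro P(2)) auto
    then show ?thesis
      unfolding f_def h_def by (rule curve_speed_affine) (use l ab in \<open>auto simp: h_def\<close>)
  qed
  ultimately have "(curve_speed atlas g (\<lambda>t. \<gamma> (l + (m - l) * t)) has_integral integral {l..m} f) {0..1}"
    using has_integral_spike_finite[OF _ _ 1] by blast
  then show ?thesis unfolding curve_length_def f_def by (rule integral_unique)
qed

lemma curve_length_nonneg: "piecewise_C1_curve atlas \<gamma> \<Longrightarrow> 0 \<le> curve_length atlas g \<gamma>"
  unfolding curve_length_def by (intro integral_nonneg curve_speed_integrable curve_speed_nonneg)

lemma dist_le_curve_length:
  assumes "piecewise_C1_curve atlas \<gamma>"
  shows "dist (\<gamma> 0) (\<gamma> 1) \<le> curve_length atlas g \<gamma>"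
  unfolding dist_riemannian[of "\<gamma> 0" "\<gamma> 1"]
  by (rule cInf_lower) (use assms curve_length_nonneg in \<open>auto intro!: bdd_belowI[of _ 0]\<close>)

lemma dist_le_integral_speed:
  assumes "piecewise_C1_curve atlas \<gamma>" and "0 \<le> l" "l \<le> m" "m \<le> 1"
  shows "dist (\<gamma> l) (\<gamma> m) \<le> integral {l..m} (curve_speed atlas g \<gamma>)"
proof (cases "l = m")
  case False
  then have "l < m" using assms by simp
  from dist_le_curve_length[OF piecewise_C1_curve_subcurve[OF assms(1,2) this assms(4)]]
  show ?thesis using curve_length_subcurve[OF assms(1,2) \<open>l < m\<close> assms(4)] by simp
qed simp

text \<open>
  The infimum of the empty set of reals is some fixed number \<open>c\<close>, so two points that no curve joins
  are at distance \<open>c\<close>. If \<open>c \<le> 0\<close>, this is impossible for distinct points. Otherwise, the set of points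
  joined to a given one contains all points at distance less than \<open>c\<close> from any of its members, so
  it is open and closed.
\<close>

lemma joined_by_curve:
  fixes x y :: 'm
  assumes "x \<noteq> y"
  shows "\<exists>\<gamma>. piecewise_C1_curve atlas \<gamma> \<and> \<gamma> 0 = x \<and> \<gamma> 1 = y"
proof -
  define J where "J x y \<longleftrightarrow> (\<exists>\<gamma>. piecewise_C1_curve atlas \<gamma> \<and> \<gamma> 0 = x \<and> \<gamma> 1 = y)" for x y :: 'm
  define c :: real where "c = Inf {}"
  have not_J: "dist x y = c" if "\<not> J x y" for x y :: 'm
  proof -
    have "{curve_length atlas g \<gamma> | \<gamma>. piecewise_C1_curve atlas \<gamma> \<and> \<gamma> 0 = x \<and> \<gamma> 1 = y} = {}"
      using that unfolding J_def by blast
    from arg_cong[OF this, of Inf] show ?thesis unfolding dist_riemannian[of x y] c_def .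
  qed
  have trans: "J x z" if xy: "J x y" and yz: "J y z" for x y z :: 'm
  proof -
    obtain \<gamma> \<gamma>' where "piecewise_C1_curve atlas \<gamma>" "\<gamma> 0 = x" "\<gamma> 1 = y"
      "piecewise_C1_curve atlas \<gamma>'" "\<gamma>' 0 = y" "\<gamma>' 1 = z"
      using xy yz unfolding J_def by blast
    then show ?thesis using piecewise_C1_curve_join[of atlas \<gamma> \<gamma>'] unfolding J_def
      by (intro exI[of _ "\<lambda>t. if t \<le> 1/2 then \<gamma> (2 * t) else \<gamma>' (2 * t - 1)"]) auto
  qed
  show ?thesis
  proof (cases "c > 0")
    case False
    then have "dist x y \<noteq> c" using assms by (metis zero_less_dist_iff)
    then show ?thesis using not_J unfolding J_def by blast
  next
    case True
    then have near: "J x y" if "dist x y < c" for x y :: 'm using not_J that by force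
    have "J x x" using near[of x x] True by simp
    have op: "open {y. J x y}"
      unfolding open_dist
    proof (intro ballI exI conjI allI impI)
      fix y z assume "y \<in> {y. J x y}" "dist z y < c"
      then show "z \<in> {y. J x y}" using trans near[of y z] by (auto simp: dist_commute)
    qed (use True in auto)
    have cl: "open (- {y. J x y})"
      unfolding open_dist
    proof (intro ballI exI conjI allI impI)
      fix y z assume "y \<in> - {y. J x y}" "dist z y < c"
      then show "z \<in> - {y. J x y}" using trans near[of z y] by auto
    qed (use True in auto)
    have "{y. J x y} = UNIV"
      using connected_clopen[of UNIV] connected_manifold op cl \<open>J x x\<close>
      by (metis (no_types, lifting) closed_def empty_iff mem_Collect_eq open_openin closed_closedin
          subtopology_UNIV)
    then show ?thesis unfolding J_def by blast
  qed
qed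

text \<open>The point is chosen on an almost shortest curve, at the proportion \<open>r / (r + s)\<close> of its length.\<close>

lemma approximate_midpoint:
  fixes x y :: 'm
  assumes d: "dist x y < r + s" and "0 < r" and "0 < s"
  shows "\<exists>z. dist x z < r \<and> dist z y < s"
proof (cases "x = y")
  case True
  then show ?thesis using assms by (intro exI[of _ x]) auto
next
  case False
  have "{curve_length atlas g \<gamma> | \<gamma>. piecewise_C1_curve atlas \<gamma> \<and> \<gamma> 0 = x \<and> \<gamma> 1 = y} \<noteq> {}"
    using joined_by_curve[OF False] by blast
  from cInf_lessD[OF this] obtain \<gamma> where
    pw: "piecewise_C1_curve atlas \<gamma>" and ends: "\<gamma> 0 = x" "\<gamma> 1 = y" and len: "curve_length atlas g \<gamma> < r + s"
    using d unfolding dist_riemannian[of x y] by blast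
  define f where "f = curve_speed atlas g \<gamma>"
  define L where "L = integral {0..1} f"
  have L: "0 \<le> L" "L < r + s"
    using curve_length_nonneg[OF pw] len unfolding L_def f_def curve_length_def by auto
  have int: "f integrable_on {0..1}" unfolding f_def by (rule curve_speed_integrable[OF pw])
  have cont: "continuous_on {0..1} (\<lambda>u. integral {0..u} f)"
    by (rule indefinite_integral_continuous_1[OF int])
  have "L * r / (r + s) \<le> L" using L \<open>0 < r\<close> \<open>0 < s\<close> by (simp add: divide_simps mult_left_mono)
  then obtain u where u: "0 \<le> u" "u \<le> 1" "integral {0..u} f = L * r / (r + s)"
    using IVT'[of "\<lambda>u. integral {0..u} f" 0 "L * r / (r + s)" 1] cont L \<open>0 < r\<close> \<open>0 < s\<close>
    unfolding L_def by auto
  have "dist x (\<gamma> u) \<le> L * r / (r + s)"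
    using dist_le_integral_speed[OF pw, of 0 u] u ends unfolding f_def by simp
  also have "\<dots> < r" using L \<open>0 < r\<close> \<open>0 < s\<close> by (simp add: divide_simps)
  finally have 1: "dist x (\<gamma> u) < r" .
  have "integral {0..u} f + integral {u..1} f = L"
    unfolding L_def by (rule Henstock_Kurzweil_Integration.integral_combine[OF u(1,2) int])
  then have "integral {u..1} f = L * s / (r + s)"
    using u(3) \<open>0 < r\<close> \<open>0 < s\<close> by (simp add: divide_simps) (simp add: algebra_simps)
  then have "dist (\<gamma> u) y \<le> L * s / (r + s)"
    using dist_le_integral_speed[OF pw, of u 1] u ends unfolding f_def by simp
  also have "\<dots> < s" using L \<open>0 < r\<close> \<open>0 < s\<close> by (simp add: divide_simps)
  finally show ?thesis using 1 by blast
qed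

lemma locally_compact: "\<exists>e>0. compact (cball (x::'m) e)"
proof -
  obtain c where c: "c \<in> atlas" "x \<in> fst c" using charts_cover by blast
  have hom: "homeomorphism (fst c) (snd c ` fst c) (snd c) (chart_inv c)" by (rule chart_homeomorphism[OF c(1)])
  have op: "open (fst c)" "open (snd c ` fst c)" using chart_open[OF c(1)] by auto
  then obtain d where d: "d > 0" "cball (snd c x) d \<subseteq> snd c ` fst c"
    using c(2) open_contains_cball[of "snd c ` fst c"] by blast
  define C where "C = chart_inv c ` cball (snd c x) d"
  have "continuous_on (cball (snd c x) d) (chart_inv c)"
    by (rule continuous_on_subset[OF homeomorphism_cont2[OF hom] d(2)])
  then have C: "compact C" unfolding C_def by (rule compact_continuous_image) simp
  have "continuous_on (fst c) (snd c)" using hom unfolding homeomorphism_def by auto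
  then have "open (fst c \<inter> snd c -` ball (snd c x) d)"
    using continuous_on_open_vimage[OF op(1), of "snd c"] by (auto simp: Int_commute)
  moreover have "x \<in> fst c \<inter> snd c -` ball (snd c x) d" using c(2) d(1) by simp
  ultimately obtain e where e: "e > 0" "cball x e \<subseteq> fst c \<inter> snd c -` ball (snd c x) d"
    using open_contains_cball by blast
  have "p \<in> C" if "p \<in> cball x e" for p
  proof -
    have p: "p \<in> fst c" "snd c p \<in> cball (snd c x) d" using e(2) that by (auto simp: less_imp_le)
    then have "p = chart_inv c (snd c p)" using hom unfolding homeomorphism_def by auto
    then show ?thesis unfolding C_def using p(2) by blast
  qed
  then have "cball x e = C \<inter> cball x e" by blast
  then have "compact (cball x e)" using compact_Int_closed[OF C, of "cball x e"] by simp
  then show ?thesis using e(1) by blast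
qed

end

section \<open>The Hopf--Rinow theorem\<close>

text \<open>
  If the radii of the compact balls about \<open>x\<close> had a finite supremum \<open>R\<close>, the ball of radius \<open>R\<close> would
  be totally bounded, as all its points are close to a smaller compact ball, hence compact; a finite
  cover of it by compact balls then contains the ball of some larger radius.
\<close>

lemma compact_cball_of_approximate_midpoints:
  fixes x :: "'a::metric_space"
  assumes complete: "complete (UNIV :: 'a set)"
    and loc: "\<And>y::'a. \<exists>e>0. compact (cball y e)"
    and mid: "\<And>(y::'a) z r s. dist y z < r + s \<Longrightarrow> 0 < r \<Longrightarrow> 0 < s \<Longrightarrow> \<exists>w. dist y w < r \<and> dist w z < s"
  shows "compact (cball x r)"
proof -
  define A where "A = {r. 0 < r \<and> compact (cball x r)}"
  have smaller: "compact (cball x r)" if "r' \<in> A" "r \<le> r'" for r r'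
  proof -
    have "cball x r = cball x r' \<inter> cball x r" using that(2) by auto
    then show ?thesis using that(1) compact_Int_closed[of "cball x r'" "cball x r"] unfolding A_def by simp
  qed
  have "\<not> bdd_above A"
  proof
    assume bdd: "bdd_above A"
    define R where "R = Sup A"
    have "A \<noteq> {}" using loc[of x] unfolding A_def by blast
    have upper: "r \<le> R" if "r \<in> A" for r unfolding R_def using bdd that by (rule cSup_upper[rotated])
    then have "0 < R" using \<open>A \<noteq> {}\<close> unfolding A_def by force
    have below: "compact (cball x r)" if "r < R" for r
      using less_cSupD[OF \<open>A \<noteq> {}\<close>, of r] that smaller unfolding R_def by (meson less_imp_le)
    have "compact (cball x R)"
      unfolding compact_eq_totally_bounded
    proof (intro conjI allI impI)
      show "complete (cball x R)" using complete_closed_subset[of "cball x R" UNIV] complete by simp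
      fix e :: real assume "0 < e"
      define e' where "e' = min R (e/4)"
      have e': "0 < e'" "e' \<le> R" "2 * e' \<le> e/2" using \<open>0 < e\<close> \<open>0 < R\<close> by (auto simp: e'_def)
      have "compact (cball x (R - e'/2))" using below e' by simp
      then obtain k where k: "finite k" "cball x (R - e'/2) \<subseteq> (\<Union>y\<in>k. ball y (e/2))"
        using \<open>0 < e\<close> unfolding compact_eq_totally_bounded by (meson half_gt_zero)
      have "y \<in> (\<Union>y\<in>k. ball y e)" if "y \<in> cball x R" for y
      proof -
        have "dist x y < (R - e'/2) + e'" using that e' by simp
        then obtain z where z: "dist x z < R - e'/2" "dist z y < e'"
          using mid[of x y "R - e'/2" e'] e' by auto
        then obtain w where "w \<in> k" "dist w z < e/2" using k(2) by force
        then have "dist w y < e" using z(2) e' dist_triangle[of w y z] by simp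
        then show ?thesis using \<open>w \<in> k\<close> by auto
      qed
      then show "\<exists>k. finite k \<and> cball x R \<subseteq> (\<Union>y\<in>k. ball y e)" using k(1) by blast
    qed
    obtain e where e: "\<And>y. 0 < e y" "\<And>y::'a. compact (cball y (e y))" using loc by metis
    have "cball x R \<subseteq> (\<Union>y\<in>cball x R. ball y (e y))" using e(1) by force
    from compactE_image[OF \<open>compact (cball x R)\<close> open_ball this]
    obtain k where k: "finite k" "cball x R \<subseteq> (\<Union>y\<in>k. ball y (e y))" by metis
    have k_open: "open (\<Union>y\<in>k. ball y (e y))" by blast
    obtain \<rho> where \<rho>: "\<rho> > 0" "(\<Union>z\<in>cball x R. cball z \<rho>) \<subseteq> (\<Union>y\<in>k. ball y (e y))"
      using compact_subset_open_imp_cball_epsilon_subset[OF \<open>compact (cball x R)\<close> k_open k(2)] by blast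
    define C where "C = (\<Union>y\<in>k. cball y (e y))"
    have "compact C" unfolding C_def using k(1) e(2) by blast
    have "y \<in> C" if "y \<in> cball x (R + \<rho>/2)" for y
    proof -
      have "dist x y < R + \<rho>" using that \<rho>(1) by simp
      then obtain z where z: "dist x z < R" "dist z y < \<rho>" using mid \<open>0 < R\<close> \<rho>(1) by blast
      then have "y \<in> (\<Union>z\<in>cball x R. cball z \<rho>)" by (auto intro!: bexI[of _ z])
      then have "y \<in> (\<Union>y\<in>k. ball y (e y))" using \<rho>(2) by blast
      then show ?thesis unfolding C_def by (auto intro: less_imp_le)
    qed
    then have "cball x (R + \<rho>/2) = C \<inter> cball x (R + \<rho>/2)" by blast
    then have "compact (cball x (R + \<rho>/2))"
      using compact_Int_closed[OF \<open>compact C\<close>, of "cball x (R + \<rho>/2)"] by simp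
    then have "R + \<rho>/2 \<in> A" using \<open>0 < R\<close> \<rho>(1) unfolding A_def by simp
    then show False using upper[of "R + \<rho>/2"] \<rho>(1) by simp
  qed
  then obtain r' where "r' \<in> A" "r \<le> r'" unfolding bdd_above_def by (meson nle_le)
  then show ?thesis by (rule smaller)
qed

lemma (in H_flow) compact_cball: "compact (cball (x::'m) r)"
  using complete_manifold locally_compact approximate_midpoint
  by (rule compact_cball_of_approximate_midpoints)

section \<open>Elementary properties of the flow\<close>

context H_flow
begin

lemma flow_minus: "\<phi> (- t) (\<phi> t x) = x"
  using flow_add[of "- t" t x] by (simp add: flow_zero)

lemma continuous_on_flow:
  assumes "continuous_on S f" and "continuous_on S h"
  shows "continuous_on S (\<lambda>s. \<phi> (f s) (h s))"
  using continuous_on_compose2[OF flow_continuous, of S "\<lambda>s. (f s, h s)"] assms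
  by (simp add: continuous_on_Pair)

lemma flow_multiple_of_period:
  assumes "\<phi> T x = x"
  shows "\<phi> (real n * T) x = x"
proof (induction n)
  case 0
  then show ?case by (simp add: flow_zero)
next
  case (Suc n)
  have "\<phi> (real (Suc n) * T) x = \<phi> (real n * T) (\<phi> T x)"
    unfolding flow_add[symmetric] by (simp add: algebra_simps)
  then show ?case using Suc assms by simp
qed

lemma flow_int_multiple_of_period:
  assumes "\<phi> T x = x"
  shows "\<phi> (of_int k * T) x = x"
proof (cases "0 \<le> k")
  case True
  then show ?thesis using flow_multiple_of_period[OF assms, of "nat k"] by simp
next
  case False
  then have "\<phi> (- (of_int k * T)) x = x" using flow_multiple_of_period[OF assms, of "nat (- k)"] by simp
  then show ?thesis using flow_minus[of "- (of_int k * T)" x] by simp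
qed

lemma flow_period_orbit: "\<phi> T (\<phi> t x) = \<phi> t x" if "\<phi> T x = x"
  by (metis flow_add add.commute that)

text \<open>The bound on the speed, required near time zero only, extends to all times.\<close>

lemma flow_displacement:
  obtains b where "b > 0" and "\<And>t x. dist x (\<phi> t x) \<le> b * \<bar>t\<bar>"
proof -
  obtain a b where ab: "0 < a" "a \<le> b" and
    local: "\<And>x. \<exists>\<rho>>0. \<forall>t\<in>{-\<rho>..\<rho>}. dist x (\<phi> t x) \<le> b * \<bar>t\<bar>"
    using speed_bounds by meson
  have pos: "dist x (\<phi> t x) \<le> b * t" if "0 \<le> t" for t x
  proof -
    define A where "A = {0..t} \<inter> {s. dist x (\<phi> s x) \<le> b * s}"
    have "compact A"
      unfolding A_def by (intro compact_Int_closed compact_Icc closed_Collect_le continuous_intros continuous_on_flow)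
    moreover have "0 \<in> A" using that by (simp add: A_def flow_zero)
    ultimately obtain s where s: "s \<in> A" "\<And>u. u \<in> A \<Longrightarrow> u \<le> s"
      using compact_attains_sup[of A] by blast
    have "s = t"
    proof (rule ccontr)
      assume "s \<noteq> t"
      then have "s < t" using s(1) by (simp add: A_def)
      obtain \<rho> where \<rho>: "\<rho> > 0" "\<And>r. r \<in> {-\<rho>..\<rho>} \<Longrightarrow> dist (\<phi> s x) (\<phi> r (\<phi> s x)) \<le> b * \<bar>r\<bar>"
        using local by meson
      define r where "r = min \<rho> (t - s)"
      have r: "0 < r" "r \<le> \<rho>" "s + r \<le> t" using \<rho>(1) \<open>s < t\<close> by (auto simp: r_def)
      have "dist x (\<phi> (r + s) x) \<le> dist x (\<phi> s x) + dist (\<phi> s x) (\<phi> r (\<phi> s x))"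
        unfolding flow_add by (rule dist_triangle)
      also have "\<dots> \<le> b * s + b * r" using s(1) \<rho>(2)[of r] r by (intro add_mono) (auto simp: A_def)
      finally have "r + s \<in> A" using r s(1) by (auto simp: A_def algebra_simps)
      then show False using s(2)[of "r + s"] r by simp
    qed
    then show ?thesis using s(1) by (simp add: A_def)
  qed
  have "dist x (\<phi> t x) \<le> b * \<bar>t\<bar>" for t x
  proof (cases "0 \<le> t")
    case False
    then show ?thesis using pos[of "- t" "\<phi> t x"] by (simp add: flow_minus dist_commute)
  qed (use pos in auto)
  then show ?thesis using that[of b] ab by simp
qed

text \<open>
  The points of a compact set are joined, up to a small error, by orbit segments whose lengths are
  taken from a fixed finite set.
\<close>

lemma finite_transition_times:
  assumes K: "compact K" and e: "0 < e"
  obtains F where "finite F" and "F \<subseteq> {0..}"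
    and "\<And>x y. x \<in> K \<Longrightarrow> y \<in> K \<Longrightarrow> \<exists>t\<in>F. \<exists>z. dist x z < e \<and> dist (\<phi> t z) y < e"
proof -
  obtain k where k: "finite k" "K \<subseteq> (\<Union>x\<in>k. ball x (e/2))"
    using K e unfolding compact_eq_totally_bounded by (meson half_gt_zero)
  have "\<exists>t\<ge>0. \<phi> t ` ball x (e/2) \<inter> ball y (e/2) \<noteq> {}" for x y
  proof -
    obtain t where "t \<ge> 1" "\<phi> t ` ball x (e/2) \<inter> ball y (e/2) \<noteq> {}"
      using transitivity[of "ball x (e/2)" "ball y (e/2)" 1] e by auto
    then show ?thesis by (intro exI[of _ t]) auto
  qed
  then obtain \<tau> where \<tau>: "\<And>x y. 0 \<le> \<tau> x y" "\<And>x y. \<phi> (\<tau> x y) ` ball x (e/2) \<inter> ball y (e/2) \<noteq> {}"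
    by metis
  show ?thesis
  proof (rule that[of "(\<lambda>(x, y). \<tau> x y) ` (k \<times> k)"])
    fix x y assume "x \<in> K" "y \<in> K"
    then obtain x' y' where x': "x' \<in> k" "dist x' x < e/2" and y': "y' \<in> k" "dist y' y < e/2"
      using k(2) unfolding subset_iff UN_iff mem_ball by blast
    obtain z where z: "dist x' z < e/2" "dist y' (\<phi> (\<tau> x' y') z) < e/2"
      using \<tau>(2)[of x' y'] by auto
    have "dist x z < e" using dist_triangle_half_r[OF x'(2) z(1)] .
    moreover have "dist (\<phi> (\<tau> x' y') z) y < e" using dist_triangle_half_r[OF z(2) y'(2)] .
    ultimately show "\<exists>t\<in>(\<lambda>(x, y). \<tau> x y) ` (k \<times> k). \<exists>z. dist x z < e \<and> dist (\<phi> t z) y < e"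
      using x'(1) y'(1) by force
  qed (use k(1) \<tau>(1) in auto)
qed

text \<open>The constants of the closing lemma can be chosen uniformly over a compact set.\<close>

lemma closing_lemma_compact:
  assumes K: "compact K" and e: "0 < e"
  obtains d T where "d > 0" and "T > 0"
    and "\<And>y t. y \<in> K \<Longrightarrow> T \<le> t \<Longrightarrow> dist (\<phi> t y) y \<le> d \<Longrightarrow>
           \<exists>z. \<exists>\<tau>\<in>{t - e..t + e}. \<phi> \<tau> z = z \<and> (\<forall>s\<in>{0..t}. dist (\<phi> s z) (\<phi> s y) \<le> e)"
proof -
  obtain k where k: "finite k" "K \<subseteq> (\<Union>x\<in>k. ball x e)"
    using K e unfolding compact_eq_totally_bounded by meson
  have "\<forall>x. \<exists>d T. d > 0 \<and> T > 0 \<and> (\<forall>y\<in>ball x e. \<forall>t\<ge>T. dist (\<phi> t y) y \<le> d \<longrightarrow>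
          (\<exists>z. \<exists>\<tau>\<in>{t - e..t + e}. \<phi> \<tau> z = z \<and> (\<forall>s\<in>{0..t}. dist (\<phi> s z) (\<phi> s y) \<le> e)))"
    using closing_lemma[OF e] by meson
  then obtain d T where dT: "\<And>x. d x > 0" "\<And>x. T x > 0"
    "\<And>x y t. y \<in> ball x e \<Longrightarrow> T x \<le> t \<Longrightarrow> dist (\<phi> t y) y \<le> d x \<Longrightarrow>
          \<exists>z. \<exists>\<tau>\<in>{t - e..t + e}. \<phi> \<tau> z = z \<and> (\<forall>s\<in>{0..t}. dist (\<phi> s z) (\<phi> s y) \<le> e)"
    by metis
  define d' where "d' = Min (insert 1 (d ` k))"
  define T' where "T' = Max (insert 1 (T ` k))"
  show ?thesis
  proof (rule that)
    show "d' > 0" unfolding d'_def using k(1) dT(1) by (subst Min_gr_iff) auto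
    have "1 \<le> T'" unfolding T'_def using k(1) by (intro Max_ge) auto
    then show "T' > 0" by simp
    fix y t assume y: "y \<in> K" and t: "T' \<le> t" "dist (\<phi> t y) y \<le> d'"
    obtain x where x: "x \<in> k" "y \<in> ball x e" using k(2) y by blast
    have "T x \<le> T'" "d' \<le> d x" unfolding T'_def d'_def using k(1) x(1) by (auto intro!: Max_ge Min_le)
    then show "\<exists>z. \<exists>\<tau>\<in>{t - e..t + e}. \<phi> \<tau> z = z \<and> (\<forall>s\<in>{0..t}. dist (\<phi> s z) (\<phi> s y) \<le> e)"
      using dT(3)[OF x(2) order_trans[OF _ t(1)] order_trans[OF t(2)]] by blast
  qed
qed

text \<open>Transitivity makes some orbit of \<open>U\<close> return close to itself, and the closing lemma closes it up.\<close>

lemma periodic_point_in_open: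
  assumes "open U" and "U \<noteq> {}"
  obtains x T where "x \<in> U" and "1 \<le> T" and "\<phi> T x = x"
proof -
  obtain u where "u \<in> U" using assms(2) by blast
  then obtain r where r: "r > 0" "ball u r \<subseteq> U" using assms(1) openE by blast
  define e where "e = r/2"
  have "e > 0" using r by (simp add: e_def)
  then obtain d T where dT: "d > 0" "T > 0"
    "\<And>y t. y \<in> ball u e \<Longrightarrow> T \<le> t \<Longrightarrow> dist (\<phi> t y) y \<le> d \<Longrightarrow>
        \<exists>z\<in>ball y e. \<exists>\<tau>\<in>{t - e..t + e}. \<phi> \<tau> z = z"
    using closing_lemma[of e u] by meson
  define \<rho> where "\<rho> = min e (d/2)"
  have \<rho>: "\<rho> > 0" "\<rho> \<le> e" "2 * \<rho> \<le> d" using \<open>e > 0\<close> dT(1) by (auto simp: \<rho>_def)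
  obtain t where t: "T + e + 1 \<le> t" "\<phi> t ` ball u \<rho> \<inter> ball u \<rho> \<noteq> {}"
    using transitivity[of "ball u \<rho>" "ball u \<rho>" "T + e + 1"] \<rho>(1) dT(2) \<open>e > 0\<close> by auto
  then obtain y where y: "dist u y < \<rho>" "dist u (\<phi> t y) < \<rho>" by auto
  have "dist (\<phi> t y) y \<le> d"
    using dist_triangle2[of "\<phi> t y" y u] y \<rho>(3) by (simp add: dist_commute)
  then obtain z \<tau> where z: "z \<in> ball y e" "\<tau> \<in> {t - e..t + e}" "\<phi> \<tau> z = z"
    using dT(3)[of y t] y(1) t(1) \<rho>(2) \<open>e > 0\<close> by auto
  have "dist u z < r"
    using dist_triangle[of u z y] z(1) y(1) \<rho>(2) by (simp add: e_def)
  then show ?thesis using that[of z \<tau>] r(2) z t(1) dT(2) by auto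
qed

lemma periodic_orbits_iff:
  "(\<exists>\<gamma>\<in>periodic_orbits \<phi>. snd \<gamma> = T \<and> fst \<gamma> \<inter> K \<noteq> {}) \<longleftrightarrow> 0 < T \<and> (\<exists>x\<in>K. \<phi> T x = x)"
proof
  assume "\<exists>\<gamma>\<in>periodic_orbits \<phi>. snd \<gamma> = T \<and> fst \<gamma> \<inter> K \<noteq> {}"
  then obtain x t where "0 < T" "\<phi> T x = x" "\<phi> t x \<in> K" unfolding periodic_orbits_def by auto
  then show "0 < T \<and> (\<exists>x\<in>K. \<phi> T x = x)" using flow_period_orbit by blast
next
  assume "0 < T \<and> (\<exists>x\<in>K. \<phi> T x = x)"
  then obtain x where x: "0 < T" "x \<in> K" "\<phi> T x = x" by blast
  have "x = \<phi> 0 x" by (simp add: flow_zero)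
  then have "x \<in> range (\<lambda>t. \<phi> t x)" by (metis rangeI)
  then show "\<exists>\<gamma>\<in>periodic_orbits \<phi>. snd \<gamma> = T \<and> fst \<gamma> \<inter> K \<noteq> {}"
    unfolding periodic_orbits_def using x by (intro bexI[of _ "(range (\<lambda>t. \<phi> t x), T)"]) auto
qed

text \<open>The minimal period is attained, since periods of points of a compact set form a closed set.\<close>

lemma min_period_attained:
  assumes K: "compact K" and int: "interior K \<noteq> {}"
  obtains x where "x \<in> K" and "\<phi> (min_period \<phi> K) x = x" and "1 \<le> min_period \<phi> K"
proof -
  define P where "P T \<longleftrightarrow> 1 \<le> T \<and> (\<exists>x\<in>K. \<phi> T x = x)" for T
  obtain x0 T0 where "x0 \<in> interior K" "1 \<le> T0" "\<phi> T0 x0 = x0"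
    using periodic_point_in_open[OF open_interior int] .
  then have T0: "P T0" unfolding P_def using interior_subset by blast
  define C where "C = ({1..T0} \<times> K) \<inter> {p. \<phi> (fst p) (snd p) = snd p}"
  have "closed {p. \<phi> (fst p) (snd p) = snd p}"
    by (intro closed_Collect_eq continuous_on_flow continuous_intros)
  then have "compact C" unfolding C_def using K by (intro compact_Int_closed compact_Times) auto
  then have "compact (fst ` C)" by (intro compact_continuous_image continuous_intros)
  moreover have "fst ` C \<noteq> {}" using T0 unfolding C_def P_def by force
  ultimately obtain T where T: "T \<in> fst ` C" "\<And>t. t \<in> fst ` C \<Longrightarrow> T \<le> t"
    using compact_attains_inf[of "fst ` C"] by blast
  have "P T" using T(1) unfolding C_def P_def by auto
  moreover have "T \<le> t" if "P t" for t
  proof (cases "t \<le> T0")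
    case True
    then show ?thesis using T(2)[of t] that unfolding C_def P_def by force
  next
    case False
    then show ?thesis using T(1) unfolding C_def by auto
  qed
  moreover have "min_period \<phi> K = (LEAST T. P T)"
    unfolding min_period_def periodic_orbits_iff P_def
    by (intro arg_cong[where f = Least] ext) auto
  ultimately have "P (min_period \<phi> K)" using Least_equality[of P T] by simp
  then show ?thesis unfolding P_def using that by blast
qed
end

section \<open>Closed orbits that follow two given orbit segments\<close>

context H_flow
begin

text \<open>
  A segment of the orbit of \<open>p\<close>, one of the orbit of \<open>q\<close>, a visit to \<open>u\<close> and \<open>n\<close> turns around the closed
  orbit of \<open>w\<close> are followed, in this order, by a closed orbit. The transition times \<open>t1\<close>, \<dots>, \<open>t4\<close> are
  independent of \<open>n\<close>, so the period can be adjusted by multiples of \<open>\<tau>\<close>; the number of segments that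
  are shadowed is independent of \<open>n\<close> too, since the \<open>n\<close> turns form a single segment.
\<close>

lemma periodic_gluing:
  assumes K: "compact K" and u: "u \<in> K" and w: "w \<in> K" "\<phi> \<tau> w = w" "0 \<le> \<tau>" and e: "0 < e" "e \<le> 1"
  obtains F Tm where "finite F" and "F \<subseteq> {0..}" and "Tm > 0"
    and "\<And>p q tp tq. p \<in> K \<Longrightarrow> q \<in> K \<Longrightarrow> \<phi> tp p \<in> K \<Longrightarrow> \<phi> tq q \<in> K \<Longrightarrow> 0 \<le> tp \<Longrightarrow> 0 \<le> tq \<Longrightarrow>
      \<exists>t1\<in>F. \<exists>t2\<in>F. \<exists>t3\<in>F. \<exists>t4\<in>F. \<forall>n T. T = tp + t1 + tq + t2 + t3 + real n * \<tau> + t4 \<longrightarrow> Tm \<le> T \<longrightarrow>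
        (\<exists>z. \<exists>\<sigma>\<in>{T - e..T + e}. \<phi> \<sigma> z = z \<and>
           (\<forall>s\<in>{0..tp}. dist (\<phi> s z) (\<phi> s p) < 2 * e) \<and>
           (\<forall>s\<in>{0..tq}. dist (\<phi> (tp + t1 + s) z) (\<phi> s q) < 2 * e) \<and>
           dist (\<phi> (tp + t1 + tq + t2) z) u < 2 * e)"
proof -
  obtain R where R: "\<And>x. x \<in> K \<Longrightarrow> dist u x \<le> R"
    using compact_imp_bounded[OF K] unfolding bounded_any_center[of K u] by blast
  define K' where "K' = cball u (R + 1)"
  have K': "compact K'" unfolding K'_def by (rule compact_cball)
  have near: "y \<in> K'" if "x \<in> K" "dist x y < 1" for x y
    using R[OF that(1)] that(2) dist_triangle[of u y x] by (simp add: K'_def)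
  have KK': "x \<in> K'" if "x \<in> K" for x using near[OF that] by simp
  obtain d Tm where d: "d > 0" "Tm > 0" and
    close: "\<And>y t. y \<in> K' \<Longrightarrow> Tm \<le> t \<Longrightarrow> dist (\<phi> t y) y \<le> d \<Longrightarrow>
           \<exists>z. \<exists>\<tau>\<in>{t - e..t + e}. \<phi> \<tau> z = z \<and> (\<forall>s\<in>{0..t}. dist (\<phi> s z) (\<phi> s y) \<le> e)"
    using closing_lemma_compact[OF K' e(1)] by metis
  define d' where "d' = min e (d/2)"
  have d': "d' > 0" "d' \<le> e" "2 * d' \<le> d" using e d by (auto simp: d'_def)
  obtain \<eta> where \<eta>: "\<eta> > 0" and
    shadow: "\<And>(x :: nat \<Rightarrow> 'm) (t :: nat \<Rightarrow> real).
           (\<forall>i\<in>{1..9}. x i \<in> K' \<and> 0 \<le> t i) \<Longrightarrow>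
           (\<forall>i\<in>{1..<9}. dist (\<phi> (t i) (x i)) (x (Suc i)) < \<eta>) \<Longrightarrow>
           (\<exists>y. \<forall>i\<in>{1..9}. \<forall>s\<in>{0..t i}.
              dist (\<phi> (s + (\<Sum>j=1..<i. t j)) y) (\<phi> s (x i)) < d')"
    using finite_exact_shadowing[OF K' d'(1), of 9] by auto
  define e' where "e' = min \<eta> e"
  have e': "e' > 0" "e' \<le> \<eta>" "e' \<le> 1" using \<eta> e by (auto simp: e'_def)
  obtain F where F: "finite F" "F \<subseteq> {0..}" and
    connect: "\<And>x y. x \<in> K \<Longrightarrow> y \<in> K \<Longrightarrow> \<exists>t\<in>F. \<exists>z. dist x z < e' \<and> dist (\<phi> t z) y < e'"
    using finite_transition_times[OF K e'(1)] by metis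
  show ?thesis
  proof (rule that[OF F d(2)])
    fix p q tp tq assume pq: "p \<in> K" "q \<in> K" "\<phi> tp p \<in> K" "\<phi> tq q \<in> K" and t: "0 \<le> tp" "0 \<le> tq"
    obtain t1 z1 where z1: "t1 \<in> F" "dist (\<phi> tp p) z1 < e'" "dist (\<phi> t1 z1) q < e'"
      using connect[OF pq(3,2)] by blast
    obtain t2 z2 where z2: "t2 \<in> F" "dist (\<phi> tq q) z2 < e'" "dist (\<phi> t2 z2) u < e'"
      using connect[OF pq(4) u] by blast
    obtain t3 z3 where z3: "t3 \<in> F" "dist u z3 < e'" "dist (\<phi> t3 z3) w < e'"
      using connect[OF u w(1)] by blast
    obtain t4 z4 where z4: "t4 \<in> F" "dist w z4 < e'" "dist (\<phi> t4 z4) p < e'"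
      using connect[OF w(1) pq(1)] by blast
    have tF: "0 \<le> t1" "0 \<le> t2" "0 \<le> t3" "0 \<le> t4" using z1(1) z2(1) z3(1) z4(1) F(2) by auto
    have zK: "z1 \<in> K'" "z2 \<in> K'" "z3 \<in> K'" "z4 \<in> K'"
      using near[OF pq(3), of z1] near[OF pq(4), of z2] near[OF u, of z3] near[OF w(1), of z4]
        z1(2) z2(2) z3(2) z4(2) e'(3) by auto
    have "\<exists>z. \<exists>\<sigma>\<in>{T - e..T + e}. \<phi> \<sigma> z = z \<and>
           (\<forall>s\<in>{0..tp}. dist (\<phi> s z) (\<phi> s p) < 2 * e) \<and>
           (\<forall>s\<in>{0..tq}. dist (\<phi> (tp + t1 + s) z) (\<phi> s q) < 2 * e) \<and>
           dist (\<phi> (tp + t1 + tq + t2) z) u < 2 * e"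
      if T: "T = tp + t1 + tq + t2 + t3 + real n * \<tau> + t4" "Tm \<le> T" for n T
    proof -
      \<comment> \<open>The segments are numbered from 1, so the entries of index 0 are irrelevant. The segments of
          length 0 at \<open>u\<close> and, for the return, at \<open>p\<close> only record that these points are approached.\<close>
      define x where "x = (!) [p, p, z1, q, z2, u, z3, w, z4, p]"
      define ts where "ts = (!) [0, tp, t1, tq, t2, 0, t3, real n * \<tau>, t4, 0]"
      have i9: "{1..9::nat} = {1,2,3,4,5,6,7,8,9}" "{1..<9::nat} = {1,2,3,4,5,6,7,8}" by auto
      have 1: "\<forall>i\<in>{1..9}. x i \<in> K' \<and> 0 \<le> ts i"
        unfolding i9 using KK' pq u w tF t zK by (simp add: x_def ts_def)
      have "\<phi> (real n * \<tau>) w = w" by (rule flow_multiple_of_period[OF w(2)])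
      then have 2: "\<forall>i\<in>{1..<9}. dist (\<phi> (ts i) (x i)) (x (Suc i)) < \<eta>"
        unfolding i9 using z1 z2 z3 z4 e'(2) by (simp add: x_def ts_def flow_zero)
      obtain y where y: "\<And>i s. i \<in> {1..9} \<Longrightarrow> s \<in> {0..ts i} \<Longrightarrow>
              dist (\<phi> (s + (\<Sum>j=1..<i. ts j)) y) (\<phi> s (x i)) < d'"
        using shadow[OF 1 2] by blast
      have y1: "dist (\<phi> s y) (\<phi> s p) < d'" if "s \<in> {0..tp}" for s
        using y[of 1 s] that by (simp add: x_def ts_def)
      have y3: "dist (\<phi> (tp + t1 + s) y) (\<phi> s q) < d'" if "s \<in> {0..tq}" for s
        using y[of 3 s] that by (simp add: x_def ts_def eval_nat_numeral add_ac)
      have y5: "dist (\<phi> (tp + t1 + tq + t2) y) u < d'"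
        using y[of 5 0] by (simp add: x_def ts_def eval_nat_numeral flow_zero add_ac)
      have y9: "dist (\<phi> T y) p < d'"
        using y[of 9 0] by (simp add: x_def ts_def eval_nat_numeral flow_zero T(1) add_ac)
      have yp: "dist y p < d'" using y1[of 0] t by (simp add: flow_zero)
      have "y \<in> K'" using near[OF pq(1), of y] yp d' e by (simp add: dist_commute)
      moreover have "dist (\<phi> T y) y \<le> d"
        using dist_triangle2[of "\<phi> T y" y p] y9 yp d'(3) by simp
      ultimately obtain z \<sigma> where z: "\<sigma> \<in> {T - e..T + e}" "\<phi> \<sigma> z = z"
        "\<And>s. s \<in> {0..T} \<Longrightarrow> dist (\<phi> s z) (\<phi> s y) \<le> e"
        using close[of y T] T(2) by blast
      have n\<tau>: "0 \<le> real n * \<tau>" using w(3) by simp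
      have tri: "dist (\<phi> s z) v < 2 * e" if "0 \<le> s" "s \<le> T" "dist (\<phi> s y) v < d'" for s v
        using dist_triangle[of "\<phi> s z" v "\<phi> s y"] z(3)[of s] that d'(2) by simp
      show ?thesis
        using z(1,2) y1 y3 y5 t tF n\<tau>
        by (intro exI[of _ z] bexI[of _ \<sigma>] conjI ballI tri) (auto simp: T(1))
    qed
    then show "\<exists>t1\<in>F. \<exists>t2\<in>F. \<exists>t3\<in>F. \<exists>t4\<in>F. \<forall>n T. T = tp + t1 + tq + t2 + t3 + real n * \<tau> + t4 \<longrightarrow> Tm \<le> T \<longrightarrow>
        (\<exists>z. \<exists>\<sigma>\<in>{T - e..T + e}. \<phi> \<sigma> z = z \<and>
           (\<forall>s\<in>{0..tp}. dist (\<phi> s z) (\<phi> s p) < 2 * e) \<and>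
           (\<forall>s\<in>{0..tq}. dist (\<phi> (tp + t1 + s) z) (\<phi> s q) < 2 * e) \<and>
           dist (\<phi> (tp + t1 + tq + t2) z) u < 2 * e)"
      using z1(1) z2(1) z3(1) z4(1) by blast
  qed
qed

text \<open>
  A coordinate along closed orbits: relative to a base point on each orbit, a point of period
  \<open>\<sigma>\<close> is reached at a time in \<open>{0..<\<sigma>}\<close>.
\<close>

lemma position_on_orbit:
  obtains pos :: "real \<Rightarrow> 'm \<Rightarrow> real" where
    "\<And>\<sigma> z. 0 < \<sigma> \<Longrightarrow> \<phi> \<sigma> z = z \<Longrightarrow> 0 \<le> pos \<sigma> z \<and> pos \<sigma> z < \<sigma>"
    "\<And>\<sigma> z z'. 0 < \<sigma> \<Longrightarrow> \<phi> \<sigma> z = z \<Longrightarrow> \<phi> \<sigma> z' = z' \<Longrightarrow> range (\<lambda>t. \<phi> t z) = range (\<lambda>t. \<phi> t z') \<Longrightarrow>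
        z' = \<phi> (pos \<sigma> z' - pos \<sigma> z) z"
proof -
  define base where "base z = (SOME x. x \<in> range (\<lambda>t. \<phi> t z))" for z
  have "\<exists>r. 0 \<le> r \<and> r < \<sigma> \<and> \<phi> r (base z) = z" if \<sigma>: "0 < \<sigma>" "\<phi> \<sigma> z = z" for \<sigma> z
  proof -
    have "base z \<in> range (\<lambda>t. \<phi> t z)" unfolding base_def by (rule someI[of _ "\<phi> 0 z"]) blast
    then obtain s where s: "base z = \<phi> s z" by blast
    define k where "k = \<lfloor>- s / \<sigma>\<rfloor>"
    define r where "r = - s - of_int k * \<sigma>"
    have "of_int k \<le> - s / \<sigma>" "- s / \<sigma> < of_int k + 1" unfolding k_def by linarith+
    then have "0 \<le> r" "r < \<sigma>" using \<sigma>(1) by (simp_all add: r_def field_simps)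
    moreover have "\<phi> r (base z) = \<phi> (of_int (- k) * \<sigma>) z"
      unfolding s flow_add[symmetric] by (simp add: r_def)
    ultimately show ?thesis using flow_int_multiple_of_period[OF \<sigma>(2), of "- k"] by metis
  qed
  then obtain pos where pos: "\<And>\<sigma> z. 0 < \<sigma> \<Longrightarrow> \<phi> \<sigma> z = z \<Longrightarrow> 0 \<le> pos \<sigma> z \<and> pos \<sigma> z < \<sigma> \<and> \<phi> (pos \<sigma> z) (base z) = z"
    by metis
  show ?thesis
  proof (rule that)
    show "0 \<le> pos \<sigma> z \<and> pos \<sigma> z < \<sigma>" if "0 < \<sigma>" "\<phi> \<sigma> z = z" for \<sigma> z using pos[OF that] by blast
    fix \<sigma> z z' assume a: "0 < \<sigma>" "\<phi> \<sigma> z = z" "\<phi> \<sigma> z' = z'" "range (\<lambda>t. \<phi> t z) = range (\<lambda>t. \<phi> t z')"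
    have "base z = base z'" using a(4) unfolding base_def by simp
    then have "z' = \<phi> (pos \<sigma> z' - pos \<sigma> z + pos \<sigma> z) (base z)" using pos[OF a(1,3)] by simp
    also have "\<dots> = \<phi> (pos \<sigma> z' - pos \<sigma> z) z" unfolding flow_add using pos[OF a(1,2)] by simp
    finally show "z' = \<phi> (pos \<sigma> z' - pos \<sigma> z) z" .
  qed
qed
end

section \<open>Counting\<close>

lemma ecard_eq: "ecard A = (if finite A then ennreal (real (card A)) else \<infinity>)"
  by (simp add: ecard_def emeasure_count_space ennreal_of_nat_eq_real_of_nat)

lemma ecard_inj_on_le:
  assumes "inj_on f A" and "f ` A \<subseteq> B"
  shows "ecard A \<le> ecard B"
proof (cases "finite B")
  case True
  then have "finite A" "card A \<le> card B"
    using inj_on_finite[OF assms] card_inj_on_le[OF assms] by auto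
  then show ?thesis using True by (simp add: ecard_eq)
qed (simp add: ecard_eq)

lemma ecard_Times: "ecard (A \<times> B) = ecard A * ecard B"
proof (cases "A = {} \<or> B = {}")
  case True
  then show ?thesis by (auto simp: ecard_eq)
next
  case False
  then have "card A \<noteq> 0" if "finite A" using that by simp
  moreover have "card B \<noteq> 0" if "finite B" using that False by simp
  ultimately show ?thesis
    using False by (auto simp: ecard_eq finite_cartesian_product_iff card_cartesian_product ennreal_mult
        ennreal_mult_top ennreal_top_mult)
qed

lemma Sup_times_Sup_le:
  fixes c :: ennreal
  assumes "\<And>a b. a \<in> A \<Longrightarrow> b \<in> B \<Longrightarrow> a * b \<le> c"
  shows "Sup A * Sup B \<le> c"
proof -
  have "Sup A * Sup B = (SUP b\<in>B. Sup A * b)" using SUP_mult_left_ennreal[of "Sup A" "\<lambda>b. b" B] by simp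
  also have "\<dots> \<le> c"
  proof (rule SUP_least)
    fix b assume "b \<in> B"
    have "Sup A * b = (SUP a\<in>A. a * b)" using SUP_mult_right_ennreal[of "\<lambda>a. a" A b] by simp
    also have "\<dots> \<le> c" by (rule SUP_least) (rule assms[OF _ \<open>b \<in> B\<close>])
    finally show "Sup A * b \<le> c" .
  qed
  finally show ?thesis .
qed

context H_flow
begin

lemma separating_eqI:
  assumes "separating \<phi> \<delta> T E" and "p \<in> E" "q \<in> E"
    and "\<And>t. t \<in> {0..T} \<Longrightarrow> dist (\<phi> t p) (\<phi> t q) < \<delta>"
  shows "p = q"
  using assms unfolding separating_def by (meson not_le)

text \<open>
  The combinatorial core. Each pair of points of two separated sets is followed by a closed orbit with
  period in \<open>{A..B}\<close>; the starting times of the second point take, for each first point, only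
  finitely many values. Then a pair is determined by its closed orbit, by the position on it up to
  the time step \<open>\<theta>\<close>, and by that value.
\<close>

lemma separated_pairs_le_periodic_orbits:
  assumes sep0: "separating \<phi> \<delta> T0 E0" and sep1: "separating \<phi> \<delta> T1 E1"
    and b: "\<And>t x. dist x (\<phi> t x) \<le> b * \<bar>t\<bar>" "0 \<le> b"
    and \<theta>: "0 < \<theta>" "4 * e + b * \<theta> \<le> \<delta>"
    and F: "finite F" and A: "0 < A" "A \<le> B"
    and follow: "\<And>p q. p \<in> E0 \<Longrightarrow> q \<in> E1 \<Longrightarrow> \<exists>z \<sigma>. \<exists>t\<in>F. A \<le> \<sigma> \<and> \<sigma> \<le> B \<and> \<phi> \<sigma> z = z \<and>
        range (\<lambda>t. \<phi> t z) \<inter> K \<noteq> {} \<and>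
        (\<forall>s\<in>{0..T0}. dist (\<phi> s z) (\<phi> s p) < 2 * e) \<and>
        (\<forall>s\<in>{0..T1}. dist (\<phi> (tp p + t + s) z) (\<phi> s q) < 2 * e)"
  shows "ecard E0 * ecard E1 \<le> ennreal ((B / \<theta> + 1) * real (card F)) * ecard (periodic_orbits_meeting \<phi> K A B)"
proof -
  obtain pos :: "real \<Rightarrow> 'm \<Rightarrow> real" where
    pos: "\<And>\<sigma> z. 0 < \<sigma> \<Longrightarrow> \<phi> \<sigma> z = z \<Longrightarrow> 0 \<le> pos \<sigma> z \<and> pos \<sigma> z < \<sigma>"
    "\<And>\<sigma> z z'. 0 < \<sigma> \<Longrightarrow> \<phi> \<sigma> z = z \<Longrightarrow> \<phi> \<sigma> z' = z' \<Longrightarrow> range (\<lambda>t. \<phi> t z) = range (\<lambda>t. \<phi> t z') \<Longrightarrow>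
        z' = \<phi> (pos \<sigma> z' - pos \<sigma> z) z"
    using position_on_orbit by metis
  define Q where "Q x z \<sigma> t \<longleftrightarrow> t \<in> F \<and> A \<le> \<sigma> \<and> \<sigma> \<le> B \<and> \<phi> \<sigma> z = z \<and> range (\<lambda>t. \<phi> t z) \<inter> K \<noteq> {} \<and>
        (\<forall>s\<in>{0..T0}. dist (\<phi> s z) (\<phi> s (fst x)) < 2 * e) \<and>
        (\<forall>s\<in>{0..T1}. dist (\<phi> (tp (fst x) + t + s) z) (\<phi> s (snd x)) < 2 * e)" for x z \<sigma> t
  have "\<exists>z \<sigma> t. Q x z \<sigma> t" if "x \<in> E0 \<times> E1" for x
    using follow[of "fst x" "snd x"] that unfolding Q_def mem_Times_iff by blast
  then obtain Z \<Sigma> \<tau> where Q: "\<And>x. x \<in> E0 \<times> E1 \<Longrightarrow> Q x (Z x) (\<Sigma> x) (\<tau> x)" by metis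
  define N where "N = nat \<lfloor>B / \<theta>\<rfloor> + 1"
  define slot where "slot x = nat \<lfloor>pos (\<Sigma> x) (Z x) / \<theta>\<rfloor>" for x
  define key where "key x = ((range (\<lambda>t. \<phi> t (Z x)), \<Sigma> x), slot x, \<tau> x)" for x
  let ?P = "periodic_orbits_meeting \<phi> K A B"
  have "key ` (E0 \<times> E1) \<subseteq> ?P \<times> ({..<N} \<times> F)"
  proof (rule image_subsetI)
    fix x assume x: "x \<in> E0 \<times> E1"
    note q = Q[OF x, unfolded Q_def]
    have "0 < \<Sigma> x" using q A by linarith
    then have "pos (\<Sigma> x) (Z x) \<le> B" using pos(1)[of "\<Sigma> x" "Z x"] q by linarith
    then have "slot x < N"
      unfolding slot_def N_def using \<theta>(1) by (auto intro!: nat_mono floor_mono divide_right_mono simp: less_Suc_eq_le)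
    moreover have "(range (\<lambda>t. \<phi> t (Z x)), \<Sigma> x) \<in> ?P"
      unfolding periodic_orbits_meeting_def periodic_orbits_def using q \<open>0 < \<Sigma> x\<close> by auto
    ultimately show "key x \<in> ?P \<times> ({..<N} \<times> F)" unfolding key_def using q by auto
  qed
  moreover have "inj_on key (E0 \<times> E1)"
  proof (rule inj_onI)
    fix x y assume x: "x \<in> E0 \<times> E1" and y: "y \<in> E0 \<times> E1" and "key x = key y"
    then have eq: "range (\<lambda>t. \<phi> t (Z x)) = range (\<lambda>t. \<phi> t (Z y))" "\<Sigma> x = \<Sigma> y" "slot x = slot y" "\<tau> x = \<tau> y"
      unfolding key_def by auto
    note qx = Q[OF x, unfolded Q_def] and qy = Q[OF y, unfolded Q_def]
    have \<sigma>: "0 < \<Sigma> x" using qx A by linarith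
    define r where "r = pos (\<Sigma> x) (Z y) - pos (\<Sigma> x) (Z x)"
    have p: "0 \<le> pos (\<Sigma> x) (Z x)" "0 \<le> pos (\<Sigma> x) (Z y)"
      using pos(1)[OF \<sigma>] qx qy eq(2) by auto
    have "nat \<lfloor>pos (\<Sigma> x) (Z x) / \<theta>\<rfloor> = nat \<lfloor>pos (\<Sigma> x) (Z y) / \<theta>\<rfloor>"
      using eq(2,3) unfolding slot_def by simp
    then have "\<lfloor>pos (\<Sigma> x) (Z x) / \<theta>\<rfloor> = \<lfloor>pos (\<Sigma> x) (Z y) / \<theta>\<rfloor>"
      using p \<theta>(1) by (subst (asm) eq_nat_nat_iff) auto
    then have "\<bar>pos (\<Sigma> x) (Z y) / \<theta> - pos (\<Sigma> x) (Z x) / \<theta>\<bar> \<le> 1" by linarith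
    then have "\<bar>r / \<theta>\<bar> \<le> 1" unfolding r_def diff_divide_distrib .
    then have r: "\<bar>r\<bar> \<le> \<theta>" using \<theta>(1) by (simp add: field_simps)
    have Zy: "Z y = \<phi> r (Z x)" unfolding r_def using pos(2)[OF \<sigma>, of "Z x" "Z y"] qx qy eq by auto
    have ZZ: "dist (\<phi> s (Z x)) (\<phi> s (Z y)) \<le> b * \<theta>" for s
    proof -
      have "\<phi> s (Z y) = \<phi> r (\<phi> s (Z x))" unfolding Zy flow_add[symmetric] by (simp add: add.commute)
      then have "dist (\<phi> s (Z x)) (\<phi> s (Z y)) \<le> b * \<bar>r\<bar>" using b(1) by simp
      also have "\<dots> \<le> b * \<theta>" using b(2) r by (rule mult_left_mono[rotated])
      finally show ?thesis .
    qed
    have tri: "dist u v < \<delta>" if "dist (\<phi> s (Z x)) u < 2 * e" "dist (\<phi> s (Z y)) v < 2 * e" for u v s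
      using that ZZ[of s] \<theta>(2) dist_triangle[of u v "\<phi> s (Z x)"] dist_triangle[of "\<phi> s (Z x)" v "\<phi> s (Z y)"]
      by (simp add: dist_commute)
    have 1: "fst x = fst y"
    proof (rule separating_eqI[OF sep0])
      fix s assume "s \<in> {0..T0}"
      then show "dist (\<phi> s (fst x)) (\<phi> s (fst y)) < \<delta>" using qx qy by (intro tri[of s]) auto
    qed (use x y in auto)
    moreover have "snd x = snd y"
    proof (rule separating_eqI[OF sep1])
      fix s assume s: "s \<in> {0..T1}"
      show "dist (\<phi> s (snd x)) (\<phi> s (snd y)) < \<delta>"
        by (rule tri[of "tp (fst x) + \<tau> x + s"]) (use qx qy s 1 eq(4) in auto)
    qed (use x y in auto)
    ultimately show "x = y" by (rule prod_eqI)
  qed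
  ultimately have "ecard (E0 \<times> E1) \<le> ecard (?P \<times> ({..<N} \<times> F))" by (rule ecard_inj_on_le[rotated])
  then have "ecard E0 * ecard E1 \<le> ecard ?P * ennreal (real N * real (card F))"
    unfolding ecard_Times using F by (simp add: ecard_eq ennreal_mult)
  also have "\<dots> \<le> ecard ?P * ennreal ((B / \<theta> + 1) * real (card F))"
  proof (intro mult_left_mono ennreal_leI mult_right_mono)
    have "0 \<le> B / \<theta>" using A \<theta>(1) by simp
    then show "real N \<le> B / \<theta> + 1" unfolding N_def by simp
  qed auto
  finally show ?thesis by (simp add: mult.commute)
qed

end

theorem proposition6p4:
  fixes atlas :: "('m::metric_space, 'e::euclidean_space) chart set"
    and g :: "('m, 'e) metric_tensor"
    and \<phi> :: "real \<Rightarrow> 'm \<Rightarrow> 'm"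
    and K\<^sub>0 K :: "'m set"
    and \<delta> \<eta> :: real
  assumes "H_flow atlas g \<phi>"
    and "compact K\<^sub>0" and "interior K\<^sub>0 \<noteq> {}"
    and "compact K" and "K\<^sub>0 \<subseteq> K"
    and "0 < \<delta>" and "\<delta> < 1"
    and "0 < \<eta>" and "\<eta> < 1"
  shows "\<exists>Tmin>0. \<exists>S\<^sub>1>0. \<exists>D\<^sub>1>0. \<forall>S\<ge>S\<^sub>1. \<forall>x\<^sub>0\<in>K. \<forall>y\<^sub>0\<in>K. \<forall>z\<^sub>0\<in>K. \<forall>T\<^sub>0\<ge>Tmin. \<forall>T\<^sub>1\<ge>Tmin.
           chord_count \<phi> x\<^sub>0 y\<^sub>0 \<eta> T\<^sub>0 (T\<^sub>0 + 5 * min_period \<phi> K\<^sub>0) \<delta> *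
           chord_count \<phi> y\<^sub>0 z\<^sub>0 \<eta> T\<^sub>1 (T\<^sub>1 + 5 * min_period \<phi> K\<^sub>0) \<delta>
           \<le> ennreal (D\<^sub>1 * (T\<^sub>0 + T\<^sub>1 + S)) *
             ecard (periodic_orbits_meeting \<phi> K\<^sub>0 (T\<^sub>0 + T\<^sub>1 + S)
                      (T\<^sub>0 + T\<^sub>1 + S + 5 * min_period \<phi> K\<^sub>0))"
proof -
  interpret H_flow atlas g \<phi> by fact
  define \<tau> where "\<tau> = min_period \<phi> K\<^sub>0"
  obtain w where w: "w \<in> K\<^sub>0" "\<phi> \<tau> w = w" "1 \<le> \<tau>"
    using min_period_attained[OF assms(2,3)] unfolding \<tau>_def by metis
  obtain u where "u \<in> interior K\<^sub>0" using assms(3) by blast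
  then obtain r where r: "r > 0" "ball u r \<subseteq> K\<^sub>0"
    using open_contains_ball[of "interior K\<^sub>0"] interior_subset[of "K\<^sub>0"] by (meson open_interior subset_trans)
  obtain b where b: "b > 0" "\<And>t x. dist x (\<phi> t x) \<le> b * \<bar>t\<bar>" using flow_displacement by metis
  \<comment> \<open>Two points followed by nearby points of one closed orbit are at distance less than
      \<open>4 * e + b * \<theta>\<close>, which must not exceed \<open>\<delta>\<close>; by \<open>2 * e \<le> r\<close>, the closed orbits meet the
      ball about \<open>u\<close> in \<open>K\<^sub>0\<close>.\<close>
  define e where "e = min (\<delta> / 8) (r / 2)"
  have e: "0 < e" "e \<le> 1" "4 * e \<le> \<delta> / 2" "2 * e \<le> r" using assms(6,7) r by (auto simp: e_def)
  define \<theta> where "\<theta> = \<delta> / (4 * b)"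
  have \<theta>: "0 < \<theta>" "4 * e + b * \<theta> \<le> \<delta>" using assms(6) b(1) e by (auto simp: \<theta>_def)
  obtain R where R: "\<And>x. x \<in> K \<Longrightarrow> dist u x \<le> R"
    using compact_imp_bounded[OF assms(4)] unfolding bounded_any_center[of K u] by blast
  define K1 where "K1 = cball u (R + 1)"
  have K1: "compact K1" unfolding K1_def by (rule compact_cball)
  have near: "y \<in> K1" if "x \<in> K" "y \<in> ball x \<eta>" for x y
    using R[OF that(1)] that(2) dist_triangle[of u y x] assms(9) by (simp add: K1_def)
  have KK1: "x \<in> K1" if "x \<in> K" for x using near[OF that, of x] assms(8) by simp
  have uK: "u \<in> K1" "w \<in> K1" using KK1 w(1) r assms(5) by (auto simp: subset_iff)
  have "0 \<le> \<tau>" using w(3) by simp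
  from periodic_gluing[OF K1 uK w(2) this e(1,2)]
  obtain F Tm where F: "finite F" "F \<subseteq> {0..}" and Tm: "Tm > 0" and
    glue: "\<And>p q tp tq. p \<in> K1 \<Longrightarrow> q \<in> K1 \<Longrightarrow> \<phi> tp p \<in> K1 \<Longrightarrow> \<phi> tq q \<in> K1 \<Longrightarrow> 0 \<le> tp \<Longrightarrow> 0 \<le> tq \<Longrightarrow>
      \<exists>t1\<in>F. \<exists>t2\<in>F. \<exists>t3\<in>F. \<exists>t4\<in>F. \<forall>n T. T = tp + t1 + tq + t2 + t3 + real n * \<tau> + t4 \<longrightarrow> Tm \<le> T \<longrightarrow>
        (\<exists>z. \<exists>\<sigma>\<in>{T - e..T + e}. \<phi> \<sigma> z = z \<and>
           (\<forall>s\<in>{0..tp}. dist (\<phi> s z) (\<phi> s p) < 2 * e) \<and>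
           (\<forall>s\<in>{0..tq}. dist (\<phi> (tp + t1 + s) z) (\<phi> s q) < 2 * e) \<and>
           dist (\<phi> (tp + t1 + tq + t2) z) u < 2 * e)"
    by metis
  define L where "L = Max (insert 0 F)"
  have L: "0 \<le> L" "\<And>t. t \<in> F \<Longrightarrow> 0 \<le> t \<and> t \<le> L" unfolding L_def using F by auto
  define D where "D = ((1 + 5 * \<tau>) / \<theta> + 1) * (real (card F) + 1)"
  have D: "D > 0" unfolding D_def using w(3) \<theta>(1) by (intro mult_pos_pos add_nonneg_pos divide_nonneg_pos) auto
  have main: "ecard E0 * ecard E1 \<le> ennreal (D * (T0 + T1 + S)) *
       ecard (periodic_orbits_meeting \<phi> K\<^sub>0 (T0 + T1 + S) (T0 + T1 + S + 5 * \<tau>))"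
    if S: "10 * \<tau> + 4 * L + 1 \<le> S" and xyz: "x0 \<in> K" "y0 \<in> K" "z0 \<in> K"
      and T: "max 1 Tm \<le> T0" "max 1 Tm \<le> T1"
      and E0: "E0 \<subseteq> chords \<phi> x0 y0 \<eta> T0 (T0 + 5 * \<tau>)" "separating \<phi> \<delta> T0 E0"
      and E1: "E1 \<subseteq> chords \<phi> y0 z0 \<eta> T1 (T1 + 5 * \<tau>)" "separating \<phi> \<delta> T1 E1"
    for S x0 y0 z0 T0 T1 E0 E1
  proof -
    define A where "A = T0 + T1 + S"
    have A: "1 \<le> A" "Tm \<le> A" unfolding A_def using T S w(3) L(1) by auto
    have "\<forall>p\<in>E0. \<exists>t. T0 \<le> t \<and> t \<le> T0 + 5 * \<tau> \<and> \<phi> t p \<in> ball y0 \<eta>" using E0(1) unfolding chords_def by fastforce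
    then obtain tp where tp: "\<And>p. p \<in> E0 \<Longrightarrow> T0 \<le> tp p \<and> tp p \<le> T0 + 5 * \<tau> \<and> \<phi> (tp p) p \<in> ball y0 \<eta>" by metis
    have "ecard E0 * ecard E1 \<le> ennreal (((A + 5 * \<tau>) / \<theta> + 1) * real (card F)) *
        ecard (periodic_orbits_meeting \<phi> K\<^sub>0 A (A + 5 * \<tau>))"
    proof (rule separated_pairs_le_periodic_orbits[OF E0(2) E1(2) b(2) _ \<theta> F(1), where tp = tp])
      fix p q assume p: "p \<in> E0" and q: "q \<in> E1"
      obtain tq where tq: "T1 \<le> tq" "tq \<le> T1 + 5 * \<tau>" "\<phi> tq q \<in> ball z0 \<eta>"
        using E1(1) q unfolding chords_def by fastforce
      have mem: "p \<in> K1" "q \<in> K1" "\<phi> (tp p) p \<in> K1" "\<phi> tq q \<in> K1"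
        using near xyz tp[OF p] tq(3) E0(1) E1(1) p q unfolding chords_def by blast+
      have nn: "0 \<le> tp p" "0 \<le> tq" using tp[OF p] tq T by auto
      obtain t1 t2 t3 t4 where t: "t1 \<in> F" "t2 \<in> F" "t3 \<in> F" "t4 \<in> F" and
        cl: "\<And>n T. T = tp p + t1 + tq + t2 + t3 + real n * \<tau> + t4 \<Longrightarrow> Tm \<le> T \<Longrightarrow>
        (\<exists>z. \<exists>\<sigma>\<in>{T - e..T + e}. \<phi> \<sigma> z = z \<and>
           (\<forall>s\<in>{0..tp p}. dist (\<phi> s z) (\<phi> s p) < 2 * e) \<and>
           (\<forall>s\<in>{0..tq}. dist (\<phi> (tp p + t1 + s) z) (\<phi> s q) < 2 * e) \<and>
           dist (\<phi> (tp p + t1 + tq + t2) z) u < 2 * e)"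
        using glue[OF mem nn] by metis
      define B where "B = tp p + t1 + tq + t2 + t3 + t4"
      have B: "B \<le> A"
        unfolding A_def B_def using L(2)[OF t(1)] L(2)[OF t(2)] L(2)[OF t(3)] L(2)[OF t(4)] tp[OF p] tq(2) S by linarith
      \<comment> \<open>The periodic orbit through \<open>w\<close> is run through as often as needed to bring the total time
          within \<open>\<tau>\<close> of \<open>A + \<tau>\<close>.\<close>
      define n where "n = nat \<lceil>(A + \<tau> - B) / \<tau>\<rceil>"
      have "(A + \<tau> - B) / \<tau> \<le> real n" "real n \<le> (A + \<tau> - B) / \<tau> + 1"
        unfolding n_def using B w(3) by (auto simp: of_nat_nat ceiling_le_iff)
      then have n: "A + \<tau> - B \<le> real n * \<tau>" "real n * \<tau> \<le> A + \<tau> - B + \<tau>"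
        using w(3) by (simp_all add: field_simps)
      define T where "T = tp p + t1 + tq + t2 + t3 + real n * \<tau> + t4"
      have TA: "A + \<tau> \<le> T" "T \<le> A + 2 * \<tau>" using n unfolding T_def B_def by auto
      then obtain z \<sigma> where z: "\<sigma> \<in> {T - e..T + e}" "\<phi> \<sigma> z = z"
        "\<forall>s\<in>{0..tp p}. dist (\<phi> s z) (\<phi> s p) < 2 * e"
        "\<forall>s\<in>{0..tq}. dist (\<phi> (tp p + t1 + s) z) (\<phi> s q) < 2 * e"
        "dist (\<phi> (tp p + t1 + tq + t2) z) u < 2 * e"
        using cl[OF T_def] A(2) w(3) by force
      have "\<phi> (tp p + t1 + tq + t2) z \<in> K\<^sub>0" using z(5) e(4) r(2) by (auto simp: dist_commute)
      then have "range (\<lambda>t. \<phi> t z) \<inter> K\<^sub>0 \<noteq> {}" by blast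
      moreover have "A \<le> \<sigma>" "\<sigma> \<le> A + 5 * \<tau>" using z(1) TA e(2) w(3) by auto
      ultimately show "\<exists>z \<sigma>. \<exists>t\<in>F. A \<le> \<sigma> \<and> \<sigma> \<le> A + 5 * \<tau> \<and> \<phi> \<sigma> z = z \<and>
        range (\<lambda>t. \<phi> t z) \<inter> K\<^sub>0 \<noteq> {} \<and>
        (\<forall>s\<in>{0..T0}. dist (\<phi> s z) (\<phi> s p) < 2 * e) \<and>
        (\<forall>s\<in>{0..T1}. dist (\<phi> (tp p + t + s) z) (\<phi> s q) < 2 * e)"
        using z(2,3,4) t(1) tp[OF p] tq(1)
        by (intro exI[of _ z] exI[of _ \<sigma>] bexI[of _ t1]) auto
    qed (use b(1) A w(3) in auto)
    also have "\<dots> \<le> ennreal (D * A) * ecard (periodic_orbits_meeting \<phi> K\<^sub>0 A (A + 5 * \<tau>))"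
    proof (intro mult_right_mono ennreal_leI)
      have "A + 5 * \<tau> \<le> (1 + 5 * \<tau>) * A" using A(1) w(3) by (simp add: algebra_simps)
      then have "(A + 5 * \<tau>) / \<theta> + 1 \<le> (1 + 5 * \<tau>) * A / \<theta> + A"
        using A(1) \<theta>(1) by (intro add_mono divide_right_mono) auto
      then have "((A + 5 * \<tau>) / \<theta> + 1) * real (card F) \<le> ((1 + 5 * \<tau>) * A / \<theta> + A) * (real (card F) + 1)"
        using A(1) w(3) \<theta>(1) by (intro mult_mono) auto
      also have "\<dots> = D * A" unfolding D_def by (simp add: algebra_simps)
      finally show "((A + 5 * \<tau>) / \<theta> + 1) * real (card F) \<le> D * A" .
    qed simp
    finally show ?thesis unfolding A_def .
  qed
  show ?thesis
  proof (intro exI conjI ballI allI impI)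
    show "0 < max 1 Tm" by simp
    show "0 < 10 * \<tau> + 4 * L + 1" using w(3) L(1) by simp
    show "0 < D" by (rule D)
    fix S x0 y0 z0 T0 T1
    assume "10 * \<tau> + 4 * L + 1 \<le> S" "x0 \<in> K" "y0 \<in> K" "z0 \<in> K" "max 1 Tm \<le> T0" "max 1 Tm \<le> T1"
    note m = main[OF this]
    show "chord_count \<phi> x0 y0 \<eta> T0 (T0 + 5 * min_period \<phi> K\<^sub>0) \<delta> *
           chord_count \<phi> y0 z0 \<eta> T1 (T1 + 5 * min_period \<phi> K\<^sub>0) \<delta>
           \<le> ennreal (D * (T0 + T1 + S)) *
             ecard (periodic_orbits_meeting \<phi> K\<^sub>0 (T0 + T1 + S)
                      (T0 + T1 + S + 5 * min_period \<phi> K\<^sub>0))"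
      unfolding \<tau>_def[symmetric] chord_count_def by (rule Sup_times_Sup_le) (use m in blast)
  qed
qed

end
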